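(* Consider a left-invariant Lorentzian problem on $G=\mathrm{Aff}_+(\mathbb R)$ given by a matrix $A=\begin{pmatrix}a&b\\c&d\end{pmatrix}$, $|A|>0$, $a\ge0$, with sectional curvature $K<0$. The Lorentzian spheres $S(R)=\{q\in G: d(\mathrm{Id},q)=R\}$, $R\in[0,+\infty]$, are as follows. (1) $S(0)=\{q\in G:\lambda_1(q)\ge0\text{ or }\lambda_2(q)\le0\}$. (2) If $R\in(0,\frac{\pi}{\Delta})$, then $$S(R)=\{(x,y)\in G:\ w^2-(y-\cos\sigma)^2=\sin^2\sigma\},\qquad w=\frac{x-\nu(y-1)}{\lambda},\quad \sigma=\Delta R;$$ it is an arc of a hyperbola noncompact in both directions. (3) $S(\frac{\pi}{\Delta})=F$. (4) If $R\in(\frac{\pi}{\Delta},+\infty)$, then $S(R)=\emptyset$. (5) $S(+\infty)=E$.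
   Context: $G=\mathrm{Aff}_+(\mathbb R)=\{(x,y)\in\mathbb R^2: y>0\}$ with product $(x_2,y_2)\cdot(x_1,y_1)=(x_2+y_2x_1,\,y_2y_1)$ and identity $\mathrm{Id}=(0,1)$; left-invariant frame $X_1=y\,\partial_x$, $X_2=y\,\partial_y$. A real matrix $A=\begin{pmatrix}a&b\\c&d\end{pmatrix}$ with $|A|=ad-bc>0$ determines the left-invariant Lorentzian form $g(u_1X_1+u_2X_2)=-v_1^2+v_2^2$, $v_1=au_1+bu_2$, $v_2=cu_1+du_2$, with time orientation in which future directed nonspacelike vectors are those with $v_1\ge|v_2|$. Standing assumption of the paper: $a\ge0$. Write $A^{-1}=\begin{pmatrix}\alpha&\beta\\ \gamma&\delta\end{pmatrix}$. The sectional curvature is $K=(c^2-a^2)/|A|^2=\gamma^2-\delta^2$. A future directed nonspacelike curve is a Lipschitz curve whose velocity is a.e. future directed nonspacelike; its Lorentzian length is $\int\sqrt{v_1^2-v_2^2}\,dt$. The Lorentzian distance $d(q_0,q_1)$ is the supremum of lengths of such curves from $q_0$ to $q_1$, and $0$ if there are none. For $K<0$: $\Delta=\sqrt{\delta^2-\gamma^2}$, $\lambda=\frac{\alpha\delta-\beta\gamma}{\Delta^2}$, $\nu=\frac{\beta\delta-\alpha\gamma}{\Delta^2}$; $\lambda_1(x,y)=(c-a)x+(d-b)(y-1)$, $\lambda_2(x,y)=(c+a)x+(d+b)(y-1)$ (here $d$ is the matrix entry), $B=\left(\frac{d+b}{c+a},0\right)$, $\lambda_3(q)=\lambda_1(q)-\lambda_1(B)$,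 $F=\{q\in G:\lambda_3(q)=0\}$, $E=\{q\in G:\lambda_3(q)<0\}$.
   Formalization: In part (2) the condition w > 0 is added to the description of S(R): the printed equation has two branches over y > 0, and points with w < 0 are not in the future of Id (for A the identity and R = π/2, the point (−√2, 1) satisfies the equation but has distance 0). *)

theory Defs
  imports "HOL-Analysis.Analysis"
begin

section \<open>The group of orientation-preserving affine maps of the line\<close>

type_synonym point = "real \<times> real"

definition Aff_plus :: "point set" where
  "Aff_plus = {(x, y). y > 0}"

definition aff_mult :: "point \<Rightarrow> point \<Rightarrow> point" where
  "aff_mult q p = (fst q + snd q * fst p, snd q * snd p)"

definition aff_Id :: point where
  "aff_Id = (0, 1)"

definition X1 :: "point \<Rightarrow> real \<times> real" where
  "X1 q = (snd q, 0)"

definition X2 :: "point \<Rightarrow> real \<times> real" where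
  "X2 q = (0, snd q)"

lemma X1_X2_left_invariant:
  assumes "(aff_mult q has_derivative D) (at p)"
  shows "D (X1 p) = X1 (aff_mult q p)" and "D (X2 p) = X2 (aff_mult q p)"
proof -
  have "(aff_mult q has_derivative (\<lambda>v. (snd q * fst v, snd q * snd v))) (at p)"
    unfolding aff_mult_def by (auto intro!: derivative_eq_intros)
  with assms have "D = (\<lambda>v. (snd q * fst v, snd q * snd v))"
    by (rule has_derivative_unique)
  then show "D (X1 p) = X1 (aff_mult q p)" "D (X2 p) = X2 (aff_mult q p)"
    by (simp_all add: X1_def X2_def aff_mult_def)
qed

text \<open>Coordinates of a tangent vector \<open>\<xi>\<close> at \<open>q\<close> in the frame \<open>X1, X2\<close>.\<close>

definition frame_coords :: "point \<Rightarrow> real \<times> real \<Rightarrow> real^2" where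
  "frame_coords q \<xi> = vector [fst \<xi> / snd q, snd \<xi> / snd q]"

lemma frame_coords_iff:
  assumes "q \<in> Aff_plus"
  shows "frame_coords q \<xi> = u \<longleftrightarrow> \<xi> = u $ 1 *\<^sub>R X1 q + u $ 2 *\<^sub>R X2 q"
  using assms
  by (cases \<xi>) (auto simp: frame_coords_def X1_def X2_def Aff_plus_def vec_eq_iff forall_2 field_simps)


section \<open>Left-invariant Lorentzian structures\<close>

text \<open>
  Left-invariant vector fields are identified with their coordinates \<open>u :: real^2\<close> in the frame
  \<open>X1, X2\<close>; then \<open>(v\<^sub>1, v\<^sub>2) = A *v u\<close>.
\<close>

definition lorentz_form :: "real^2^2 \<Rightarrow> real^2 \<Rightarrow> real^2 \<Rightarrow> real" where
  "lorentz_form A u w = - (A *v u) $ 1 * (A *v w) $ 1 + (A *v u) $ 2 * (A *v w) $ 2"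

definition future_nonspacelike :: "real^2^2 \<Rightarrow> real^2 \<Rightarrow> bool" where
  "future_nonspacelike A u \<longleftrightarrow> (A *v u) $ 1 \<ge> \<bar>(A *v u) $ 2\<bar>"

text \<open>The Lie bracket of left-invariant fields, determined by \<open>[X2, X1] = X1\<close>.\<close>

definition lie_bracket :: "real^2 \<Rightarrow> real^2 \<Rightarrow> real^2" where
  "lie_bracket u w = vector [u $ 2 * w $ 1 - u $ 1 * w $ 2, 0]"

text \<open>The Levi-Civita connection on left-invariant fields, given by the Koszul formula.\<close>

definition levi_civita :: "real^2^2 \<Rightarrow> real^2 \<Rightarrow> real^2 \<Rightarrow> real^2" where
  "levi_civita A u w = (THE m. \<forall>z. 2 * lorentz_form A m z =
     lorentz_form A (lie_bracket u w) z - lorentz_form A (lie_bracket w z) u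
       + lorentz_form A (lie_bracket z u) w)"

definition curvature_op :: "real^2^2 \<Rightarrow> real^2 \<Rightarrow> real^2 \<Rightarrow> real^2 \<Rightarrow> real^2" where
  "curvature_op A u w z =
     levi_civita A u (levi_civita A w z) - levi_civita A w (levi_civita A u z)
       - levi_civita A (lie_bracket u w) z"

definition sectional_curvature :: "real^2^2 \<Rightarrow> real" where
  "sectional_curvature A = (let e1 = axis 1 1; e2 = axis 2 1 in
     lorentz_form A (curvature_op A e1 e2 e2) e1 /
       (lorentz_form A e1 e1 * lorentz_form A e2 e2 - (lorentz_form A e1 e2)\<^sup>2))"

lemma levi_civita_eq:
  fixes A :: "real^2^2"
  assumes "det A \<noteq> 0"
  defines "g11 \<equiv> (A $ 2 $ 1)\<^sup>2 - (A $ 1 $ 1)\<^sup>2"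
    and "g12 \<equiv> A $ 2 $ 1 * A $ 2 $ 2 - A $ 1 $ 1 * A $ 1 $ 2"
    and "g22 \<equiv> (A $ 2 $ 2)\<^sup>2 - (A $ 1 $ 2)\<^sup>2"
  shows "levi_civita A u w =
    ((g11 * u $ 1 + g12 * u $ 2) / (det A)\<^sup>2) *\<^sub>R
      vector [g22 * w $ 2 + g12 * w $ 1, - g11 * w $ 1 - g12 * w $ 2]"
proof -
  have form: "lorentz_form A s t =
      g11 * s $ 1 * t $ 1 + g12 * (s $ 1 * t $ 2 + s $ 2 * t $ 1) + g22 * s $ 2 * t $ 2" for s t
    unfolding lorentz_form_def g11_def g12_def g22_def
    by (simp add: matrix_vector_mult_def sum_2 power2_eq_square algebra_simps)
  have gram: "g12\<^sup>2 - g11 * g22 = (det A)\<^sup>2"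
    unfolding g11_def g12_def g22_def det_2 by algebra
  define h where "h = g11 * u $ 1 + g12 * u $ 2"
  have koszul: "lorentz_form A (lie_bracket u w) z - lorentz_form A (lie_bracket w z) u
       + lorentz_form A (lie_bracket z u) w = 2 * h * (w $ 1 * z $ 2 - w $ 2 * z $ 1)" for z
    unfolding form h_def lie_bracket_def by (simp add: algebra_simps)
  define m0 :: "real^2" where "m0 = (h / (det A)\<^sup>2) *\<^sub>R
      vector [g22 * w $ 2 + g12 * w $ 1, - g11 * w $ 1 - g12 * w $ 2]"
  have D0: "(det A)\<^sup>2 \<noteq> 0"
    using assms(1) by simp
  have m0: "2 * lorentz_form A m0 z = 2 * h * (w $ 1 * z $ 2 - w $ 2 * z $ 1)" for z
  proof -
    have "lorentz_form A m0 z =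
        (h / (det A)\<^sup>2) * ((g12\<^sup>2 - g11 * g22) * (w $ 1 * z $ 2 - w $ 2 * z $ 1))"
      unfolding form m0_def by (simp add: algebra_simps power2_eq_square add_divide_distrib diff_divide_distrib)
    then show ?thesis
      using D0 unfolding gram by simp
  qed
  have uniq: "m = m0"
    if m: "\<forall>z. 2 * lorentz_form A m z = 2 * h * (w $ 1 * z $ 2 - w $ 2 * z $ 1)" for m
  proof -
    have eq: "lorentz_form A m z = lorentz_form A m0 z" for z
      using m m0 by simp
    define n where "n = m - m0"
    have 1: "g11 * n $ 1 + g12 * n $ 2 = 0"
      using eq[of "vector [1, 0]"] unfolding form n_def by (simp add: algebra_simps)
    have 2: "g12 * n $ 1 + g22 * n $ 2 = 0"
      using eq[of "vector [0, 1]"] unfolding form n_def by (simp add: algebra_simps)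
    have "(g12\<^sup>2 - g11 * g22) * n $ 1 = 0" "(g12\<^sup>2 - g11 * g22) * n $ 2 = 0"
      using 1 2 by algebra+
    then have "n $ 1 = 0" "n $ 2 = 0"
      using D0 unfolding gram by simp_all
    then show ?thesis
      by (simp add: n_def vec_eq_iff forall_2)
  qed
  have "levi_civita A u w = m0"
    unfolding levi_civita_def koszul using m0 uniq by (intro the_equality) auto
  then show ?thesis
    by (simp add: m0_def h_def)
qed

lemma sectional_curvature_eq:
  fixes A :: "real^2^2"
  assumes "det A \<noteq> 0"
  shows "sectional_curvature A = ((A $ 2 $ 1)\<^sup>2 - (A $ 1 $ 1)\<^sup>2) / (det A)\<^sup>2"
proof -
  define g11 where "g11 = (A $ 2 $ 1)\<^sup>2 - (A $ 1 $ 1)\<^sup>2"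
  define g12 where "g12 = A $ 2 $ 1 * A $ 2 $ 2 - A $ 1 $ 1 * A $ 1 $ 2"
  define g22 where "g22 = (A $ 2 $ 2)\<^sup>2 - (A $ 1 $ 2)\<^sup>2"
  note lc = levi_civita_eq[OF assms, folded g11_def g12_def g22_def]
  have form: "lorentz_form A s t =
      g11 * s $ 1 * t $ 1 + g12 * (s $ 1 * t $ 2 + s $ 2 * t $ 1) + g22 * s $ 2 * t $ 2" for s t
    unfolding lorentz_form_def g11_def g12_def g22_def
    by (simp add: matrix_vector_mult_def sum_2 power2_eq_square algebra_simps)
  have gram: "g11 * g22 - g12\<^sup>2 = - (det A)\<^sup>2"
    unfolding g11_def g12_def g22_def det_2 by algebra
  have D0: "(det A)\<^sup>2 \<noteq> 0"
    using assms by simp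
  define e1 :: "real^2" where "e1 = axis 1 1"
  define e2 :: "real^2" where "e2 = axis 2 1"
  have e [simp]: "e1 $ 1 = 1" "e1 $ 2 = 0" "e2 $ 1 = 0" "e2 $ 2 = 1"
    by (simp_all add: e1_def e2_def axis_def)
  have "curvature_op A e1 e2 e2 = (g11 / (det A)\<^sup>2) *\<^sub>R vector [g22, - g12]"
    unfolding curvature_op_def lc lie_bracket_def
    by (simp add: vec_eq_iff forall_2 algebra_simps)
  then have "lorentz_form A (curvature_op A e1 e2 e2) e1 =
      (g11 / (det A)\<^sup>2) * (g11 * g22 - g12\<^sup>2)"
    unfolding form by (simp add: algebra_simps power2_eq_square diff_divide_distrib)
  moreover have "lorentz_form A e1 e1 * lorentz_form A e2 e2 - (lorentz_form A e1 e2)\<^sup>2 =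
      g11 * g22 - g12\<^sup>2"
    unfolding form by simp
  ultimately have "sectional_curvature A = g11 / (det A)\<^sup>2"
    using D0 unfolding sectional_curvature_def Let_def e1_def[symmetric] e2_def[symmetric]
    by (simp add: gram)
  then show ?thesis
    by (simp add: g11_def)
qed

text \<open>The velocity of a Lipschitz curve exists almost everywhere, so requiring differentiability
  below is no restriction.\<close>

definition future_curve :: "real^2^2 \<Rightarrow> (real \<Rightarrow> point) \<Rightarrow> real \<Rightarrow> real \<Rightarrow> bool" where
  "future_curve A q t0 t1 \<longleftrightarrow>
     t0 < t1 \<and> q ` {t0..t1} \<subseteq> Aff_plus \<and> (\<exists>L. L-lipschitz_on {t0..t1} q) \<and>
     (AE t in lebesgue. t \<in> {t0..t1} \<longrightarrow>
        q differentiable (at t within {t0..t1}) \<and>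
        future_nonspacelike A
          (frame_coords (q t) (vector_derivative q (at t within {t0..t1}))))"

definition lorentz_length :: "real^2^2 \<Rightarrow> (real \<Rightarrow> point) \<Rightarrow> real \<Rightarrow> real \<Rightarrow> ennreal" where
  "lorentz_length A q t0 t1 =
     (\<integral>\<^sup>+ t \<in> {t0..t1}.
        (let u = frame_coords (q t) (vector_derivative q (at t within {t0..t1}))
         in ennreal (sqrt (- lorentz_form A u u))) \<partial>lebesgue)"

text \<open>The supremum of the empty set in \<open>ennreal\<close> is \<open>0\<close>.\<close>

definition lorentz_dist :: "real^2^2 \<Rightarrow> point \<Rightarrow> point \<Rightarrow> ennreal" where
  "lorentz_dist A q0 q1 =
     Sup {lorentz_length A q t0 t1 | q t0 t1. future_curve A q t0 t1 \<and> q t0 = q0 \<and> q t1 = q1}"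

definition lorentz_sphere :: "real^2^2 \<Rightarrow> ennreal \<Rightarrow> point set" where
  "lorentz_sphere A R = {q \<in> Aff_plus. lorentz_dist A aff_Id q = R}"


section \<open>Constants and functions attached to the matrix\<close>

text \<open>With \<open>matrix_inv A\<close> having rows \<open>(\<alpha>, \<beta>)\<close> and \<open>(\<gamma>, \<delta>)\<close>.\<close>

definition Delta :: "real^2^2 \<Rightarrow> real" where
  "Delta A = (let M = matrix_inv A in sqrt ((M $ 2 $ 2)\<^sup>2 - (M $ 2 $ 1)\<^sup>2))"

lemma matrix_inv_2x2:
  fixes A :: "real^2^2"
  assumes "det A \<noteq> 0"
  shows "matrix_inv A = vector [vector [A $ 2 $ 2 / det A, - A $ 1 $ 2 / det A],
                                vector [- A $ 2 $ 1 / det A, A $ 1 $ 1 / det A]]"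
    (is "_ = ?M")
proof -
  have M: "A ** ?M = mat 1" "?M ** A = mat 1"
    using assms
    by (simp_all add: vec_eq_iff forall_2 matrix_matrix_mult_def sum_2 mat_def
        flip: diff_divide_distrib add_divide_distrib)
      (simp_all add: det_2 algebra_simps)
  then have inv: "A ** matrix_inv A = mat 1"
    unfolding matrix_inv_def
    by (rule someI2[of "\<lambda>B. A ** B = mat 1 \<and> B ** A = mat 1", OF conjI]) simp
  have "matrix_inv A = (?M ** A) ** matrix_inv A"
    using M by simp
  also have "\<dots> = ?M"
    unfolding matrix_mul_assoc[symmetric] inv by simp
  finally show ?thesis .
qed

lemma Delta_squared:
  fixes A :: "real^2^2"
  assumes "det A \<noteq> 0" and "sectional_curvature A < 0"
  shows "(Delta A)\<^sup>2 = - sectional_curvature A"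
proof -
  have "(matrix_inv A $ 2 $ 2)\<^sup>2 - (matrix_inv A $ 2 $ 1)\<^sup>2 = - sectional_curvature A"
    unfolding matrix_inv_2x2[OF assms(1)] sectional_curvature_eq[OF assms(1)]
    by (simp add: power_divide flip: diff_divide_distrib minus_divide_left)
      (metis minus_diff_eq minus_divide_left)
  then show ?thesis
    using assms(2) by (simp add: Delta_def Let_def)
qed

definition lam :: "real^2^2 \<Rightarrow> real" where
  "lam A = (let M = matrix_inv A in
     (M $ 1 $ 1 * M $ 2 $ 2 - M $ 1 $ 2 * M $ 2 $ 1) / (Delta A)\<^sup>2)"

definition nu :: "real^2^2 \<Rightarrow> real" where
  "nu A = (let M = matrix_inv A in
     (M $ 1 $ 2 * M $ 2 $ 2 - M $ 1 $ 1 * M $ 2 $ 1) / (Delta A)\<^sup>2)"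

definition lam1 :: "real^2^2 \<Rightarrow> point \<Rightarrow> real" where
  "lam1 A q = (A $ 2 $ 1 - A $ 1 $ 1) * fst q + (A $ 2 $ 2 - A $ 1 $ 2) * (snd q - 1)"

definition lam2 :: "real^2^2 \<Rightarrow> point \<Rightarrow> real" where
  "lam2 A q = (A $ 2 $ 1 + A $ 1 $ 1) * fst q + (A $ 2 $ 2 + A $ 1 $ 2) * (snd q - 1)"

definition pt_B :: "real^2^2 \<Rightarrow> point" where
  "pt_B A = ((A $ 2 $ 2 + A $ 1 $ 2) / (A $ 2 $ 1 + A $ 1 $ 1), 0)"

definition lam3 :: "real^2^2 \<Rightarrow> point \<Rightarrow> real" where
  "lam3 A q = lam1 A q - lam1 A (pt_B A)"

definition set_F :: "real^2^2 \<Rightarrow> point set" where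
  "set_F A = {q \<in> Aff_plus. lam3 A q = 0}"

definition set_E :: "real^2^2 \<Rightarrow> point set" where
  "set_E A = {q \<in> Aff_plus. lam3 A q < 0}"

text \<open>In the coordinates \<open>(w, y)\<close> future directed nonspacelike velocities are those with
  \<open>w' \<ge> \<bar>y'\<bar>\<close>.  The equation \<open>w\<^sup>2 - (y - cos \<sigma>)\<^sup>2 = (sin \<sigma>)\<^sup>2\<close> describes both branches of a
  hyperbola; the one in the future of \<open>aff_Id\<close> is singled out by \<open>w > 0\<close>.\<close>

definition w_coord :: "real^2^2 \<Rightarrow> point \<Rightarrow> real" where
  "w_coord A q = (fst q - nu A * (snd q - 1)) / lam A"


section \<open>Hyperbola arcs\<close>

text \<open>A hyperbola is a nondegenerate conic (the symmetric matrix with rows \<open>(p, k, l)\<close>,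
  \<open>(k, r, m)\<close>, \<open>(l, m, n)\<close> has nonzero determinant) whose quadratic part is indefinite.\<close>

definition hyperbola :: "point set \<Rightarrow> bool" where
  "hyperbola H \<longleftrightarrow> (\<exists>p k r l m n.
     k\<^sup>2 - p * r > 0 \<and>
     p * (r * n - m\<^sup>2) - k * (k * n - l * m) + l * (k * m - l * r) \<noteq> 0 \<and>
     H = {(x, y). p * x\<^sup>2 + 2 * k * x * y + r * y\<^sup>2 + 2 * l * x + 2 * m * y + n = 0})"

text \<open>Noncompactness in both directions refers to the ambient space \<open>Aff_plus\<close>: each of the two
  ends of the arc leaves every compact subset of \<open>Aff_plus\<close> (an end may well converge in the
  plane to a point of the line \<open>y = 0\<close>).\<close>

definition hyperbola_arc_noncompact_both :: "point set \<Rightarrow> bool" where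
  "hyperbola_arc_noncompact_both S \<longleftrightarrow> (\<exists>H g.
     hyperbola H \<and> S \<subseteq> H \<and> S \<subseteq> Aff_plus \<and>
     continuous_on UNIV g \<and> inj g \<and> range g = S \<and>
     (\<forall>C. compact C \<and> C \<subseteq> Aff_plus \<longrightarrow>
        (\<forall>\<^sub>F t :: real in at_top. g t \<notin> C) \<and> (\<forall>\<^sub>F t in at_bot. g t \<notin> C)))"

end

theory Submission
  imports Defs
begin

text \<open>
  In the coordinates \<open>w = w_coord A q\<close> and \<open>y = snd q\<close> every left-invariant structure of
  negative curvature becomes the same model, up to the factor \<open>\<Delta>\<close>: the half-plane \<open>y > 0\<close>
  with length element \<open>sqrt (w'\<^sup>2 - y'\<^sup>2) / (\<Delta> y)\<close>, future cone \<open>w' \<ge> \<bar>y'\<bar>\<close> and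
  base point \<open>(0, 1)\<close> (\<open>future_nonspacelike_iff\<close>, \<open>sqrt_lorentz_form\<close>).  The lines
  \<open>lam1 = 0\<close>, \<open>lam2 = 0\<close> and \<open>lam3 = 0\<close> become \<open>w = y - 1\<close>, \<open>w = 1 - y\<close> and
  \<open>w = y + 1\<close>.  The theorem follows from the distance from the identity
  (\<open>lorentz_dist_Id\<close>): it is \<open>0\<close> for \<open>w < \<bar>y - 1\<bar>\<close>, it is \<open>\<infinity>\<close> for \<open>w > y + 1\<close>, and in
  between it is \<open>\<sigma> / \<Delta>\<close>, where \<open>cos \<sigma> = (1 + y\<^sup>2 - w\<^sup>2) / (2 y)\<close>; the last equation is that
  of the hyperbola in the statement.

  The upper bound is a calibration.  The timelike geodesics of the model are the arcs
  \<open>y\<^sup>2 = r\<^sup>2 + (w - w0)\<^sup>2\<close>.  For a fixed centre \<open>w0\<close> they form a family orthogonal to the level lines of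
  \<open>arcsin ((w - w0) / y)\<close>, a function whose gradient has length one in the
  metric without the factor \<open>\<Delta>\<close>, so this function grows along every causal curve at least as fast as \<open>\<Delta>\<close> times the length does.  Choosing \<open>w0\<close> such that
  one of these arcs joins \<open>(0, 1)\<close> to the given point makes the total growth equal to \<open>\<sigma>\<close>
  (\<open>arcsin_add_arcsin_center\<close>).  On the boundary lines \<open>w = \<bar>y - 1\<bar>\<close> and \<open>w = y + 1\<close> the
  calibrating function may fail to be Lipschitz along the curve; replacing \<open>y\<close> by \<open>y + e\<close> in
  it and letting \<open>e\<close> tend to \<open>0\<close> covers these cases too (\<open>causal_length_le_arcsin_diff\<close>).
  Since curves are merely Lipschitz, passing from velocities to increments uses
  the fundamental theorem of calculus for Lipschitz functions (\<open>lipschitz_ftc\<close>).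

  The lower bounds come from explicit curves (\<open>graph_curve_dist_ge\<close>): the graph of a function
  over \<open>w\<close> that descends along the null line \<open>y = 1 - w\<close>, follows a chosen arc, and
  climbs along the null line through the end point (the null pieces may be trivial).
  For \<open>\<bar>y - 1\<bar> < w < y + 1\<close> the arc is
  the geodesic, which has length exactly \<open>\<sigma> / \<Delta>\<close>.  A curve that comes close to the point
  \<open>(1, 0)\<close> of the boundary gains much length there: a segment of small constant height has
  arbitrarily large length if there is room for it, which is the case \<open>w > y + 1\<close>; for \<open>w = y + 1\<close> there
  is room only for flattened hyperbola arcs around \<open>(1, 0)\<close>, whose lengths approach \<open>\<pi> / \<Delta>\<close>.
\<close>

section \<open>Lipschitz functions and their almost everywhere derivatives\<close>

text \<open>
  The difference quotients of \<open>F\<close> are bounded by the Lipschitz constant and converge to \<open>f\<close>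
  almost everywhere, so by dominated convergence their integrals converge to that of \<open>f\<close>.
  The integral of a difference quotient telescopes into two averages of \<open>F\<close> near the end points,
  which tend to the values there.
\<close>

lemma lipschitz_ftc:
  fixes F f :: "real \<Rightarrow> real"
  assumes "a < b" and lip: "L-lipschitz_on {a..b} F"
    and deriv: "AE t in lebesgue. t \<in> {a..b} \<longrightarrow> (F has_real_derivative f t) (at t within {a..b})"
  shows "(f has_integral F b - F a) {a..b}"
proof -
  obtain N where N: "negligible N"
    and der: "\<And>t. t \<in> {a..b} \<Longrightarrow> t \<notin> N \<Longrightarrow> (F has_real_derivative f t) (at t within {a..b})"
    using deriv unfolding eventually_ae_filter_negligible by blast
  define N' where "N' = insert a (insert b N)"
  have N': "negligible N'"
    using N by (simp add: N'_def)
  \<comment> \<open>Constant continuation to the right of \<open>b\<close> keeps the quotients defined on all of \<open>{a..b}\<close>.\<close>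
  define G where "G t = F (min b t)" for t
  have G_lip: "\<bar>G s - G t\<bar> \<le> L * \<bar>s - t\<bar>" if "a \<le> s" "a \<le> t" for s t
  proof -
    have "dist (F (min b s)) (F (min b t)) \<le> L * dist (min b s) (min b t)"
      using that \<open>a < b\<close> by (intro lipschitz_onD[OF lip]) auto
    also have "\<dots> \<le> L * \<bar>s - t\<bar>"
      using lipschitz_on_nonneg[OF lip] by (intro mult_left_mono) (auto simp: dist_real_def)
    finally show ?thesis
      by (simp add: G_def dist_real_def)
  qed
  have L: "0 \<le> L"
    using lipschitz_on_nonneg[OF lip] .
  have "L-lipschitz_on {a..} G"
    using G_lip L by (intro lipschitz_onI) (auto simp: dist_real_def)
  then have G_cont: "continuous_on {a..} G"
    by (rule lipschitz_on_continuous_on)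
  have G_int: "G integrable_on {s..t}" if "a \<le> s" for s t
    using that by (intro integrable_continuous_real continuous_on_subset[OF G_cont]) auto
  define h where "h n = 1 / real (Suc n)" for n
  have h: "h n > 0" for n
    by (simp add: h_def)
  have h0: "h \<longlonglongrightarrow> 0"
    unfolding h_def by (rule LIMSEQ_Suc[OF lim_1_over_n])
  define q where "q n t = (G (t + h n) - G t) / h n" for n t
  have shift: "((\<lambda>t. G (t + h n)) has_integral integral {a + h n..b + h n} G) {a..b}" for n
    using integrable_integral[OF G_int[of "a + h n" "b + h n"]] h[of n]
      has_integral_shift_Icc_real[of G "h n" _ a b]
    by (simp add: o_def add.commute)
  have q_int: "(q n has_integral F b - integral {a..a + h n} G / h n) {a..b}" for n
  proof -
    have I: "(q n has_integral (integral {a + h n..b + h n} G - integral {a..b} G) / h n) {a..b}"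
      unfolding q_def
      by (intro has_integral_divide has_integral_diff shift integrable_integral G_int) simp
    have "integral {a..a + h n} G + integral {a + h n..b + h n} G = integral {a..b + h n} G"
      using h[of n] \<open>a < b\<close> by (intro Henstock_Kurzweil_Integration.integral_combine G_int) auto
    moreover have "integral {a..b} G + integral {b..b + h n} G = integral {a..b + h n} G"
      using h[of n] \<open>a < b\<close> by (intro Henstock_Kurzweil_Integration.integral_combine G_int) auto
    moreover have "integral {b..b + h n} G = integral {b..b + h n} (\<lambda>t. F b)"
      by (intro integral_cong) (auto simp: G_def)
    ultimately have "(integral {a + h n..b + h n} G - integral {a..b} G) / h n
        = F b - integral {a..a + h n} G / h n"
      using h[of n] by (simp add: field_simps)
    with I show ?thesis by simp
  qed
  have avg: "(\<lambda>n. integral {a..a + h n} G / h n) \<longlonglongrightarrow> F a"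
  proof -
    have "\<bar>integral {a..a + h n} G / h n - F a\<bar> \<le> L * h n" for n
    proof -
      have "integral {a..a + h n} (\<lambda>t. G t - F a) = integral {a..a + h n} G - h n * F a"
        using h[of n] G_int by (subst integral_diff) auto
      moreover have "norm (integral {a..a + h n} (\<lambda>t. G t - F a)) \<le> L * h n * (a + h n - a)"
      proof (rule integral_bound)
        show "continuous_on {a..a + h n} (\<lambda>t. G t - F a)"
          by (intro continuous_intros continuous_on_subset[OF G_cont]) auto
        fix t assume "t \<in> {a..a + h n}"
        then show "norm (G t - F a) \<le> L * h n"
          using G_lip[of t a] L \<open>a < b\<close> mult_left_mono[of "\<bar>t - a\<bar>" "h n" L]
          by (auto simp: G_def)
      qed (use h[of n] in auto)
      ultimately have "\<bar>integral {a..a + h n} G - h n * F a\<bar> / h n \<le> L * h n"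
        using h[of n] by (simp add: field_simps)
      moreover have "\<bar>integral {a..a + h n} G - h n * F a\<bar> / h n = \<bar>integral {a..a + h n} G / h n - F a\<bar>"
        using h[of n] by (simp add: abs_if field_simps)
      ultimately show ?thesis by simp
    qed
    then show ?thesis
      by (intro LIM_zero_cancel[OF Lim_null_comparison[OF _ tendsto_mult_right_zero[OF h0, of L]]])
         (auto)
  qed
  define q' where "q' n t = (if t \<in> N' then 0 else q n t)" for n t
  define f' where "f' t = (if t \<in> N' then 0 else f t)" for t
  have q'_int: "(q' n has_integral F b - integral {a..a + h n} G / h n) {a..b}" for n
    by (rule has_integral_spike[OF N' _ q_int]) (auto simp: q'_def)
  have bound: "norm (q' n t) \<le> L" if "t \<in> {a..b}" for n t
    using G_lip[of "t + h n" t] h[of n] that L by (auto simp: q'_def q_def field_simps)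
  have lim: "(\<lambda>n. q' n t) \<longlonglongrightarrow> f' t" if t: "t \<in> {a..b}" for t
  proof (cases "t \<in> N'")
    case False
    then have "a < t" "t < b" "t \<notin> N"
      using t by (auto simp: N'_def)
    then have "(F has_real_derivative f t) (at t)"
      using der[of t] t by (simp add: at_within_Icc_at)
    then have D: "((\<lambda>e. (F (t + e) - F t) / e) \<longlongrightarrow> f t) (at 0)"
      by (simp add: DERIV_def)
    have "filterlim h (at 0) sequentially"
      using h0 h by (simp add: filterlim_at less_imp_neq[symmetric])
    from filterlim_compose[OF D this]
    have "(\<lambda>n. (F (t + h n) - F t) / h n) \<longlonglongrightarrow> f t" .
    moreover have "\<forall>\<^sub>F n in sequentially. (F (t + h n) - F t) / h n = q' n t"
    proof -
      have "\<forall>\<^sub>F n in sequentially. h n < b - t"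
        using h0 \<open>t < b\<close> by (intro order_tendstoD) auto
      then show ?thesis
        by eventually_elim (use False \<open>t < b\<close> in \<open>auto simp: q'_def q_def G_def min_def\<close>)
    qed
    ultimately have "(\<lambda>n. q' n t) \<longlonglongrightarrow> f t"
      by (rule Lim_transform_eventually)
    then show ?thesis
      using False by (simp add: f'_def)
  qed (simp add: q'_def f'_def)
  have DC: "f' integrable_on {a..b}" "(\<lambda>n. integral {a..b} (q' n)) \<longlonglongrightarrow> integral {a..b} f'"
    using dominated_convergence[of q' "{a..b}" "\<lambda>_. L" f'] q'_int bound lim
    by (auto simp: integrable_on_def)
  have "(\<lambda>n. integral {a..b} (q' n)) \<longlonglongrightarrow> F b - F a"
    using tendsto_diff[OF tendsto_const avg] by (simp add: integral_unique[OF q'_int])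
  then have "integral {a..b} f' = F b - F a"
    using DC(2) LIMSEQ_unique by blast
  then have "(f' has_integral F b - F a) {a..b}"
    using DC(1) by (metis has_integral_integral)
  then show ?thesis
    by (rule has_integral_spike[OF N', rotated]) (auto simp: f'_def)
qed

lemma lipschitz_mono_if_deriv_nonneg:
  fixes F f :: "real \<Rightarrow> real"
  assumes lip: "L-lipschitz_on {a..b} F"
    and deriv: "AE t in lebesgue. t \<in> {a..b} \<longrightarrow>
      (F has_real_derivative f t) (at t within {a..b}) \<and> f t \<ge> 0"
    and st: "a \<le> s" "s \<le> t" "t \<le> b"
  shows "F s \<le> F t"
proof (cases "s = t")
  case False
  then have "s < t" using st by simp
  have sub: "{s..t} \<subseteq> {a..b}" using st by auto
  have I: "(f has_integral F t - F s) {s..t}"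
  proof (rule lipschitz_ftc[OF \<open>s < t\<close>])
    show "L-lipschitz_on {s..t} F"
      using lip sub by (rule lipschitz_on_subset)
    show "AE r in lebesgue. r \<in> {s..t} \<longrightarrow> (F has_real_derivative f r) (at r within {s..t})"
      using deriv by eventually_elim (use sub in \<open>auto intro: DERIV_subset\<close>)
  qed
  obtain N where N: "negligible N" and f: "\<And>r. r \<in> {a..b} \<Longrightarrow> r \<notin> N \<Longrightarrow> f r \<ge> 0"
    using deriv unfolding eventually_ae_filter_negligible by blast
  have "((\<lambda>r. if r \<in> N then 0 else f r) has_integral F t - F s) {s..t}"
    by (rule has_integral_spike[OF N _ I]) auto
  then have "0 \<le> F t - F s"
    by (rule has_integral_nonneg) (use f sub in auto)
  then show ?thesis by simp
qed simp

text \<open>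
  Lengths of curves are bounded above in this way: \<open>g\<close> may be an arbitrary function, so that the
  measurability of the speed of a curve is never an issue.
\<close>

lemma nn_integral_le_lipschitz_increment:
  fixes F f :: "real \<Rightarrow> real"
  assumes "a < b" and lip: "L-lipschitz_on {a..b} F"
    and deriv: "AE t in lebesgue. t \<in> {a..b} \<longrightarrow>
      (F has_real_derivative f t) (at t within {a..b}) \<and> 0 \<le> f t \<and> g t \<le> ennreal (f t)"
  shows "(\<integral>\<^sup>+ t\<in>{a..b}. g t \<partial>lebesgue) \<le> ennreal (F b - F a)"
proof -
  have I: "(f has_integral F b - F a) {a..b}"
    using deriv by (intro lipschitz_ftc[OF \<open>a < b\<close> lip]) auto
  obtain N where N: "negligible N" and f: "\<And>r. r \<in> {a..b} \<Longrightarrow> r \<notin> N \<Longrightarrow> f r \<ge> 0"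
    using deriv unfolding eventually_ae_filter_negligible by blast
  have "((\<lambda>r. max 0 (f r)) has_integral F b - F a) {a..b}"
    by (rule has_integral_spike[OF N _ I]) (use f in \<open>auto simp: max_def\<close>)
  then have "(\<integral>\<^sup>+ t. ennreal (max 0 (f t)) * indicator {a..b} t \<partial>lborel) = ennreal (F b - F a)"
    by (rule nn_integral_has_integral_lebesgue'[rotated]) auto
  moreover have "(\<integral>\<^sup>+ t\<in>{a..b}. g t \<partial>lebesgue) \<le> (\<integral>\<^sup>+ t. ennreal (max 0 (f t)) * indicator {a..b} t \<partial>lebesgue)"
  proof (rule nn_integral_mono_AE)
    show "AE t in lebesgue. g t * indicator {a..b} t \<le> ennreal (max 0 (f t)) * indicator {a..b} t"
      using deriv by eventually_elim (auto simp: indicator_def max_def)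
  qed
  ultimately show ?thesis by (simp add: nn_integral_completion)
qed

section \<open>Calibration of the half-plane\<close>

lemma lipschitz_on_ln:
  fixes f :: "'a::metric_space \<Rightarrow> real"
  assumes f: "L-lipschitz_on X f" and m: "m > 0" "\<And>x. x \<in> X \<Longrightarrow> m \<le> f x"
  shows "(L / m)-lipschitz_on X (\<lambda>x. ln (f x))"
proof (rule lipschitz_onI)
  have L: "0 \<le> L" using lipschitz_on_nonneg[OF f] .
  show "0 \<le> L / m" using L m by simp
  have *: "ln (f x) - ln (f y) \<le> L / m * dist x y" if "x \<in> X" "y \<in> X" for x y
  proof -
    have pos: "f x > 0" "f y > 0" "m \<le> f y" using m that by force+
    have "ln (f x) - ln (f y) \<le> (f x - f y) / f y"
      using pos by (intro ln_diff_le) auto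
    also have "\<dots> \<le> \<bar>f x - f y\<bar> / m"
      using pos m by (intro frac_le) auto
    also have "\<dots> \<le> (L * dist x y) / m"
      using lipschitz_onD[OF f that] m by (intro divide_right_mono) (auto simp: dist_real_def)
    finally show ?thesis by simp
  qed
  show "dist (ln (f x)) (ln (f y)) \<le> L / m * dist x y" if "x \<in> X" "y \<in> X" for x y
    using *[OF that] *[OF that(2,1)] by (simp add: dist_real_def dist_commute abs_le_iff)
qed

text \<open>
  The Gudermannian function at \<open>z / 2\<close>, plus \<open>\<pi> / 2\<close>.  With \<open>Q = y + s\<close> and \<open>P = y - s\<close> it expresses
  \<open>arcsin (s / y) + \<pi> / 2\<close> as \<open>gd (ln Q - ln P)\<close>.  The inner function is
  separated in the null coordinates and the outer one is globally Lipschitz, whereas \<open>arcsin\<close> is not.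
\<close>

definition gd :: "real \<Rightarrow> real" where
  "gd z = 2 * arctan (exp (z / 2))"

lemma gd_deriv: "(gd has_real_derivative exp (z / 2) / (1 + (exp (z / 2))\<^sup>2)) (at z within X)"
proof -
  have "1 + (exp (z / 2))\<^sup>2 \<noteq> 0"
    by (smt (verit) zero_le_power2)
  then show ?thesis
    unfolding gd_def by (auto intro!: derivative_eq_intros simp: divide_simps)
qed

lemma gd_lipschitz: "1-lipschitz_on UNIV gd"
proof (rule lipschitz_onI)
  fix x y :: real
  have "norm (gd x - gd y) \<le> 1 * norm (x - y)"
  proof (rule field_differentiable_bound[OF convex_UNIV gd_deriv])
    fix z :: real
    have "exp (z / 2) \<le> 1 + (exp (z / 2))\<^sup>2"
      using sum_power2_ge_zero[of "exp (z / 2) - 1 / 2" 0] by (simp add: power2_eq_square algebra_simps)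
    then show "norm (exp (z / 2) / (1 + (exp (z / 2))\<^sup>2)) \<le> 1"
      by (simp add: divide_le_eq_1 add_pos_pos)
  qed auto
  then show "dist (gd x) (gd y) \<le> 1 * dist x y"
    by (simp add: dist_norm)
qed simp

lemma gd_ln_ratio:
  assumes "P > 0" "Q > 0"
  shows "gd (ln Q - ln P) = arcsin ((Q - P) / (Q + P)) + pi / 2"
proof -
  define E where "E = exp ((ln Q - ln P) / 2)"
  have E2: "E\<^sup>2 = Q / P"
    using assms by (simp add: E_def power2_eq_square exp_add[symmetric] exp_diff)
  have E: "E > 0" by (simp add: E_def)
  define \<theta> where "\<theta> = arctan E"
  have \<theta>: "0 < \<theta>" "\<theta> < pi / 2"
    using E arctan_ubound by (auto simp: \<theta>_def)
  have "sin (2 * \<theta> - pi / 2) = - cos (2 * \<theta>)"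
    by (simp add: sin_diff)
  also have "\<dots> = (sin \<theta>)\<^sup>2 - (cos \<theta>)\<^sup>2"
    by (simp add: cos_double)
  also have "\<dots> = (E\<^sup>2 - 1) / (1 + E\<^sup>2)"
    by (simp add: \<theta>_def sin_arctan cos_arctan power_divide diff_divide_distrib add_nonneg_pos)
  also have "\<dots> = (Q - P) / (Q + P)"
    unfolding E2 using assms by (simp add: divide_simps add.commute)
  finally have "arcsin ((Q - P) / (Q + P)) = arcsin (sin (2 * \<theta> - pi / 2))"
    by simp
  also have "\<dots> = 2 * \<theta> - pi / 2"
    using \<theta> by (intro arcsin_sin) auto
  finally have "arcsin ((Q - P) / (Q + P)) = 2 * \<theta> - pi / 2" .
  then show ?thesis
    by (simp add: gd_def \<theta>_def E_def)
qed

text \<open>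
  The calibration inequality, in null coordinates \<open>Q\<close>, \<open>P\<close> with rates \<open>r = Q'\<close> and
  \<open>p = - P'\<close>: the right-hand side is the derivative of \<open>gd (ln Q - ln P)\<close>, the left-hand side
  is the speed.  It is the inequality of the arithmetic and geometric means for \<open>r / E\<close> and \<open>E p\<close>.
\<close>

lemma calibration_rate:
  fixes P Q r p :: real
  assumes "P > 0" "Q > 0" "r \<ge> 0" "p \<ge> 0"
  defines "E \<equiv> exp ((ln Q - ln P) / 2)"
  shows "2 * sqrt (r * p) / (Q + P) \<le> E / (1 + E\<^sup>2) * (r / Q + p / P)"
proof -
  have E2: "E\<^sup>2 = Q / P"
    using assms by (simp add: E_def power2_eq_square exp_add[symmetric] exp_diff)
  have E: "E > 0" by (simp add: E_def)
  have Q: "Q = E\<^sup>2 * P" using E2 assms by simp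
  have "sqrt (r * p) = sqrt (r / E * (E * p))"
    using E by simp
  also have "\<dots> \<le> (r / E + E * p) / 2"
    using E assms by (intro arith_geo_mean_sqrt) auto
  finally have "2 * sqrt (r * p) \<le> r / E + E * p" by simp
  then have "2 * sqrt (r * p) / (Q + P) \<le> (r / E + E * p) / (Q + P)"
    using assms by (intro divide_right_mono) auto
  also have "\<dots> = E / (1 + E\<^sup>2) * (r / Q + p / P)"
  proof -
    have "1 + E\<^sup>2 > 0" by (simp add: add_pos_nonneg)
    moreover have "0 < E\<^sup>2 * P + P"
      using E assms(1) by (intro add_pos_pos mult_pos_pos) auto
    ultimately have "1 + E\<^sup>2 \<noteq> 0" "E\<^sup>2 * P + P \<noteq> 0"
      by simp_all
    then show ?thesis
      unfolding Q using E assms(1) by (simp add: divide_simps) (simp add: algebra_simps power2_eq_square)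
  qed
  finally show ?thesis .
qed

text \<open>
  Both \<open>W + Y\<close> and \<open>W - Y\<close> move monotonically along a causal curve, so the two end conditions
  keep the whole curve in the closed quadrant \<open>\<bar>W - w0\<bar> \<le> Y\<close> on which the calibrating function is
  defined.  There the null coordinates \<open>Y + e \<plusminus> (W - w0)\<close> are at least \<open>e\<close>, which makes the
  function Lipschitz along the curve.  Replacing \<open>Y\<close> by \<open>Y + e\<close> changes the speed by at most the
  factor \<open>1 + e / m\<close>, where \<open>m\<close> is the minimum of \<open>Y\<close> on the curve.  The factor \<open>k\<close> stands for \<open>\<Delta>\<close>;
  it is kept inside the integral because the integrand need not be measurable.
\<close>

lemma causal_length_le_arcsin_diff:
  fixes W Y w' y' :: "real \<Rightarrow> real"
  assumes k: "k > 0" and t: "t0 < t1"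
    and lip: "LW-lipschitz_on {t0..t1} W" "LY-lipschitz_on {t0..t1} Y"
    and pos: "\<And>t. t \<in> {t0..t1} \<Longrightarrow> Y t > 0"
    and deriv: "AE t in lebesgue. t \<in> {t0..t1} \<longrightarrow>
      (W has_real_derivative w' t) (at t within {t0..t1}) \<and>
      (Y has_real_derivative y' t) (at t within {t0..t1}) \<and> \<bar>y' t\<bar> \<le> w' t"
    and start: "\<bar>W t0 - w0\<bar> \<le> Y t0" and final: "\<bar>W t1 - w0\<bar> \<le> Y t1"
  shows "(\<integral>\<^sup>+ t\<in>{t0..t1}. ennreal (sqrt ((w' t)\<^sup>2 - (y' t)\<^sup>2) / (k * Y t)) \<partial>lebesgue)
    \<le> ennreal ((arcsin ((W t1 - w0) / Y t1) - arcsin ((W t0 - w0) / Y t0)) / k)"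
proof -
  have "continuous_on {t0..t1} Y"
    using lip by (rule_tac lipschitz_on_continuous_on)
  then obtain s where s: "s \<in> {t0..t1}" "\<And>t. t \<in> {t0..t1} \<Longrightarrow> Y s \<le> Y t"
    using continuous_attains_inf[of "{t0..t1}" Y] t by auto
  define m where "m = Y s"
  have m: "m > 0" "\<And>t. t \<in> {t0..t1} \<Longrightarrow> m \<le> Y t"
    using s pos by (auto simp: m_def)
  have mono1: "W t0 + Y t0 \<le> W t + Y t" if "t \<in> {t0..t1}" for t
  proof (rule lipschitz_mono_if_deriv_nonneg[OF lipschitz_on_add[OF lip], of "\<lambda>t. w' t + y' t"])
    show "AE t in lebesgue. t \<in> {t0..t1} \<longrightarrow> ((\<lambda>x. W x + Y x) has_real_derivative w' t + y' t)
        (at t within {t0..t1}) \<and> 0 \<le> w' t + y' t"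
      using deriv by eventually_elim (auto intro!: derivative_eq_intros)
  qed (use that in auto)
  have mono2: "W t - Y t \<le> W t1 - Y t1" if "t \<in> {t0..t1}" for t
  proof (rule lipschitz_mono_if_deriv_nonneg[OF lipschitz_on_diff[OF lip], of "\<lambda>t. w' t - y' t"])
    show "AE t in lebesgue. t \<in> {t0..t1} \<longrightarrow> ((\<lambda>x. W x - Y x) has_real_derivative w' t - y' t)
        (at t within {t0..t1}) \<and> 0 \<le> w' t - y' t"
      using deriv by eventually_elim (auto intro!: derivative_eq_intros)
  qed (use that in auto)
  define I where "I = (\<integral>\<^sup>+ t\<in>{t0..t1}. ennreal (sqrt ((w' t)\<^sup>2 - (y' t)\<^sup>2) / (k * Y t)) \<partial>lebesgue)"
  define B where "B e = ((1 + e / m) / k) *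
    (arcsin ((W t1 - w0) / (Y t1 + e)) - arcsin ((W t0 - w0) / (Y t0 + e)))" for e
  have I_le: "I \<le> ennreal (B e)" if e: "e > 0" for e
  proof -
    define Q where "Q t = Y t + e + (W t - w0)" for t
    define P where "P t = Y t + e - (W t - w0)" for t
    have Q: "e \<le> Q t" and P: "e \<le> P t" if "t \<in> {t0..t1}" for t
      using mono1[OF that] mono2[OF that] start final by (auto simp: Q_def P_def)
    define E where "E t = exp ((ln (Q t) - ln (P t)) / 2)" for t
    define f where "f t = ((1 + e / m) / k) *
      (E t / (1 + (E t)\<^sup>2) * ((y' t + w' t) / Q t + (w' t - y' t) / P t))" for t
    have "I \<le> ennreal (((1 + e / m) / k) * gd (ln (Q t1) - ln (P t1)) - ((1 + e / m) / k) * gd (ln (Q t0) - ln (P t0)))"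
      unfolding I_def
    proof (rule nn_integral_le_lipschitz_increment[OF t])
      have "(LY + 0 + (LW + 0))-lipschitz_on {t0..t1} Q" "(LY + 0 + (LW + 0))-lipschitz_on {t0..t1} P"
        unfolding Q_def P_def by (intro lipschitz_intros lip)+
      then have "((LY + 0 + (LW + 0)) / e + (LY + 0 + (LW + 0)) / e)-lipschitz_on {t0..t1} (\<lambda>t. ln (Q t) - ln (P t))"
        using Q P e by (intro lipschitz_on_diff lipschitz_on_ln) auto
      from lipschitz_on_compose2[OF this lipschitz_on_subset[OF gd_lipschitz]]
      have "(1 * ((LY + 0 + (LW + 0)) / e + (LY + 0 + (LW + 0)) / e))-lipschitz_on {t0..t1} (\<lambda>t. gd (ln (Q t) - ln (P t)))"
        by simp
      from lipschitz_on_cmult_real[OF this]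
      show "(\<bar>(1 + e / m) / k\<bar> * (1 * ((LY + 0 + (LW + 0)) / e + (LY + 0 + (LW + 0)) / e)))-lipschitz_on {t0..t1}
          (\<lambda>t. ((1 + e / m) / k) * gd (ln (Q t) - ln (P t)))" .
      show "AE t in lebesgue. t \<in> {t0..t1} \<longrightarrow>
         ((\<lambda>t. ((1 + e / m) / k) * gd (ln (Q t) - ln (P t))) has_real_derivative f t) (at t within {t0..t1}) \<and>
         0 \<le> f t \<and> ennreal (sqrt ((w' t)\<^sup>2 - (y' t)\<^sup>2) / (k * Y t)) \<le> ennreal (f t)"
        using deriv
      proof eventually_elim
        case (elim t)
        show ?case
        proof
          assume tt: "t \<in> {t0..t1}"
          with elim have W: "(W has_real_derivative w' t) (at t within {t0..t1})"
            and Y: "(Y has_real_derivative y' t) (at t within {t0..t1})" and c: "\<bar>y' t\<bar> \<le> w' t"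
            by auto
          have QP: "Q t > 0" "P t > 0" using Q[OF tt] P[OF tt] e by auto
          have dQ: "(Q has_real_derivative (y' t + w' t)) (at t within {t0..t1})"
            unfolding Q_def by (auto intro!: derivative_eq_intros W Y)
          have dP: "(P has_real_derivative (y' t - w' t)) (at t within {t0..t1})"
            unfolding P_def by (auto intro!: derivative_eq_intros W Y)
          have dz: "((\<lambda>t. ln (Q t) - ln (P t)) has_real_derivative
              (y' t + w' t) / Q t + (w' t - y' t) / P t) (at t within {t0..t1})"
            using QP by (auto intro!: derivative_eq_intros dQ dP simp: field_simps)
          have "((\<lambda>t. gd (ln (Q t) - ln (P t))) has_real_derivative
              E t / (1 + (E t)\<^sup>2) * ((y' t + w' t) / Q t + (w' t - y' t) / P t)) (at t within {t0..t1})"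
            unfolding E_def by (rule DERIV_chain2[OF gd_deriv[of _ UNIV] dz])
          then have 1: "((\<lambda>t. ((1 + e / m) / k) * gd (ln (Q t) - ln (P t))) has_real_derivative f t) (at t within {t0..t1})"
            unfolding f_def by (rule DERIV_cmult)
          have QPY: "Q t + P t = 2 * (Y t + e)" by (simp add: Q_def P_def)
          have diff_squares: "(w' t)\<^sup>2 - (y' t)\<^sup>2 = (y' t + w' t) * (w' t - y' t)"
            by (simp add: power2_eq_square algebra_simps)
          have sq: "(y' t)\<^sup>2 \<le> (w' t)\<^sup>2" using c by (simp add: power2_le_iff_abs_le)
          have Yt: "Y t > 0" "m \<le> Y t" using pos m tt by auto
          have "sqrt ((w' t)\<^sup>2 - (y' t)\<^sup>2) / (k * Y t) \<le> ((1 + e / m) / k) * (sqrt ((w' t)\<^sup>2 - (y' t)\<^sup>2) / (Y t + e))"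
          proof -
            have "(Y t + e) / Y t \<le> 1 + e / m"
              using Yt m(1) e by (simp add: add_divide_distrib frac_le)
            then have "(Y t + e) / Y t * (sqrt ((w' t)\<^sup>2 - (y' t)\<^sup>2) / (k * (Y t + e)))
                \<le> (1 + e / m) * (sqrt ((w' t)\<^sup>2 - (y' t)\<^sup>2) / (k * (Y t + e)))"
              using sq Yt e k by (intro mult_right_mono divide_nonneg_nonneg) auto
            moreover have "(Y t + e) / Y t * (sqrt ((w' t)\<^sup>2 - (y' t)\<^sup>2) / (k * (Y t + e)))
                = sqrt ((w' t)\<^sup>2 - (y' t)\<^sup>2) / (k * Y t)"
              using Yt e by simp
            ultimately show ?thesis by simp
          qed
          also have "sqrt ((w' t)\<^sup>2 - (y' t)\<^sup>2) / (Y t + e) = 2 * sqrt ((y' t + w' t) * (w' t - y' t)) / (Q t + P t)"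
            unfolding QPY diff_squares by (rule mult_divide_mult_cancel_left[symmetric]) simp
          also have "((1 + e / m) / k) * \<dots> \<le> f t"
            unfolding f_def E_def using QP c e m(1) k
            by (intro mult_left_mono calibration_rate) auto
          finally have 2: "sqrt ((w' t)\<^sup>2 - (y' t)\<^sup>2) / (k * Y t) \<le> f t" .
          have "0 \<le> sqrt ((w' t)\<^sup>2 - (y' t)\<^sup>2) / (k * Y t)"
            using sq Yt k by simp
          with 2 have "0 \<le> f t" by simp
          with 1 2 show "((\<lambda>t. ((1 + e / m) / k) * gd (ln (Q t) - ln (P t))) has_real_derivative f t) (at t within {t0..t1}) \<and>
            0 \<le> f t \<and> ennreal (sqrt ((w' t)\<^sup>2 - (y' t)\<^sup>2) / (k * Y t)) \<le> ennreal (f t)"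
            by (intro conjI ennreal_leI)
        qed
      qed
    qed
    also have "((1 + e / m) / k) * gd (ln (Q t1) - ln (P t1)) - ((1 + e / m) / k) * gd (ln (Q t0) - ln (P t0)) = B e"
    proof -
      have *: "gd (ln (Q t) - ln (P t)) = arcsin ((W t - w0) / (Y t + e)) + pi / 2" if "t \<in> {t0..t1}" for t
      proof -
        have "(Q t - P t) / (Q t + P t) = (2 * (W t - w0)) / (2 * (Y t + e))"
          by (simp add: Q_def P_def)
        also have "\<dots> = (W t - w0) / (Y t + e)"
          by (rule mult_divide_mult_cancel_left) simp
        finally show ?thesis
          using gd_ln_ratio[of "P t" "Q t"] Q[OF that] P[OF that] e by simp
      qed
      show ?thesis
        using t unfolding B_def right_diff_distrib[symmetric] by (simp add: *)
    qed
    finally show ?thesis .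
  qed
  have lim: "((\<lambda>e. arcsin (x / (y + e))) \<longlongrightarrow> arcsin (x / y)) (at_right 0)" if "\<bar>x\<bar> \<le> y" "y > 0" for x y :: real
  proof (rule continuous_on_tendsto_compose[OF continuous_on_arcsin'])
    show "((\<lambda>e. x / (y + e)) \<longlongrightarrow> x / y) (at_right 0)"
      using that by (auto intro!: tendsto_eq_intros)
    show "x / y \<in> {-1..1}"
      using that by (auto simp: divide_simps)
    show "\<forall>\<^sub>F e in at_right 0. x / (y + e) \<in> {-1..1}"
      using eventually_at_right_less[of "0::real"]
      by eventually_elim (use that in \<open>auto simp: divide_simps\<close>)
  qed
  have "(B \<longlongrightarrow> ((1 + 0 / m) / k) * (arcsin ((W t1 - w0) / Y t1) - arcsin ((W t0 - w0) / Y t0))) (at_right 0)"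
    unfolding B_def using start final t pos[of t0] pos[of t1] m(1) k
    by (intro tendsto_intros lim) auto
  then have "((\<lambda>e. ennreal (B e)) \<longlongrightarrow> ennreal ((arcsin ((W t1 - w0) / Y t1) - arcsin ((W t0 - w0) / Y t0)) / k)) (at_right 0)"
    by (intro tendsto_ennrealI) simp
  moreover have "\<forall>\<^sub>F e in at_right 0. I \<le> ennreal (B e)"
    using eventually_at_right_less[of "0::real"] by eventually_elim (rule I_le)
  ultimately show ?thesis
    unfolding I_def by (intro tendsto_lowerbound) auto
qed

text \<open>
  The number \<open>w0\<close> is the centre of the geodesic from \<open>(0, 1)\<close> to \<open>(w, y)\<close>: it solves
  \<open>1 - w0\<^sup>2 = y\<^sup>2 - (w - w0)\<^sup>2\<close>, both sides being \<open>r\<^sup>2\<close>.  This equation turns the cosine of the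
  sum of the two angles into the right-hand side.
\<close>

lemma arcsin_add_arcsin_center:
  fixes w y :: real
  assumes y: "y > 0" and w: "\<bar>y - 1\<bar> \<le> w" "w \<le> y + 1" "w > 0"
  defines "w0 \<equiv> (1 + w\<^sup>2 - y\<^sup>2) / (2 * w)"
  shows "\<bar>w0\<bar> \<le> 1" and "\<bar>w - w0\<bar> \<le> y"
    and "arcsin ((w - w0) / y) + arcsin w0 = arccos ((1 + y\<^sup>2 - w\<^sup>2) / (2 * y))"
proof -
  have w0: "2 * w * w0 = 1 + w\<^sup>2 - y\<^sup>2"
    using w by (simp add: w0_def)
  have eq: "(w - w0)\<^sup>2 + (1 - w0\<^sup>2) = y\<^sup>2"
    using w0 by (simp add: power2_eq_square algebra_simps)
  show le1: "\<bar>w0\<bar> \<le> 1"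
  proof -
    have "(w - 1)\<^sup>2 \<le> y\<^sup>2" "y\<^sup>2 \<le> (w + 1)\<^sup>2"
      using w y by (auto simp: abs_le_square_iff[symmetric])
    then have "2 * w * w0 \<le> 2 * w * 1" "2 * w * (- 1) \<le> 2 * w * w0"
      unfolding w0 by (simp_all add: power2_eq_square algebra_simps)
    then have "w0 \<le> 1" "- 1 \<le> w0"
      using w(3) mult_left_le_imp_le[of "2 * w" w0 1] mult_left_le_imp_le[of "2 * w" "- 1" w0]
      by linarith+
    then show ?thesis by simp
  qed
  then have "w0\<^sup>2 \<le> 1" by (simp add: abs_square_le_1)
  then have "(w - w0)\<^sup>2 \<le> y\<^sup>2" using eq by linarith
  then show le2: "\<bar>w - w0\<bar> \<le> y"
    using y by (simp add: abs_le_square_iff[symmetric])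
  define p where "p = (w - w0) / y"
  have p: "\<bar>p\<bar> \<le> 1" using le2 y by (simp add: p_def)
  have "1 - p\<^sup>2 = (1 - w0\<^sup>2) / y\<^sup>2"
    using eq y by (simp add: p_def power_divide field_simps)
  then have "sqrt (1 - p\<^sup>2) * sqrt (1 - w0\<^sup>2) = (1 - w0\<^sup>2) / y"
    using y \<open>w0\<^sup>2 \<le> 1\<close> by (simp add: real_sqrt_divide)
  then have "cos (arcsin p + arcsin w0) = (1 - w0\<^sup>2) / y - p * w0"
    using p le1 by (simp add: cos_add cos_arcsin abs_le_iff)
  also have "\<dots> = (1 - w0 * w) / y"
    using y by (simp add: p_def power2_eq_square field_simps)
  also have "\<dots> = (1 + y\<^sup>2 - w\<^sup>2) / (2 * y)"
  proof -
    have "2 * (1 - w0 * w) = 1 + y\<^sup>2 - w\<^sup>2" using w0 by (simp add: algebra_simps)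
    then show ?thesis using y by (metis mult_divide_mult_cancel_left zero_neq_numeral)
  qed
  finally have cos: "cos (arcsin p + arcsin w0) = (1 + y\<^sup>2 - w\<^sup>2) / (2 * y)" .
  have "- w0 \<le> p"
  proof -
    have "(w - w0 + w0 * y) * (2 * w) = 2 * w\<^sup>2 + (y - 1) * (2 * w * w0)"
      by (simp add: power2_eq_square algebra_simps)
    also have "\<dots> = (w\<^sup>2 - (y - 1)\<^sup>2) * (1 + y)"
      unfolding w0 by (simp add: power2_eq_square algebra_simps)
    also have "\<dots> \<ge> 0"
      using w y by (intro mult_nonneg_nonneg) (auto simp: abs_le_square_iff[symmetric])
    finally have "0 \<le> w - w0 + w0 * y"
      using w(3) by (simp add: zero_le_mult_iff)
    then show ?thesis
      using y by (simp add: p_def field_simps)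
  qed
  then have "arcsin (- w0) \<le> arcsin p"
    using p le1 by (intro arcsin_le_arcsin) auto
  then have "0 \<le> arcsin p + arcsin w0"
    using le1 by (simp add: arcsin_minus abs_le_iff)
  moreover have "arcsin p + arcsin w0 \<le> pi"
    using arcsin_bounded[of p] arcsin_bounded[of w0] p le1 by (auto simp: abs_le_iff)
  ultimately have "arccos (cos (arcsin p + arcsin w0)) = arcsin p + arcsin w0"
    by (rule arccos_cos)
  then show "arcsin ((w - w0) / y) + arcsin w0 = arccos ((1 + y\<^sup>2 - w\<^sup>2) / (2 * y))"
    by (simp add: cos flip: p_def)
qed

lemma cos_ratio_bounds:
  fixes w y :: real
  assumes y: "y > 0" and w: "\<bar>y - 1\<bar> \<le> w" "w \<le> y + 1"
  shows "- 1 \<le> (1 + y\<^sup>2 - w\<^sup>2) / (2 * y)" and "(1 + y\<^sup>2 - w\<^sup>2) / (2 * y) \<le> 1"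
proof -
  have "(y - 1)\<^sup>2 \<le> w\<^sup>2" "w\<^sup>2 \<le> (y + 1)\<^sup>2"
    using w by (auto simp: abs_le_square_iff[symmetric])
  then show "- 1 \<le> (1 + y\<^sup>2 - w\<^sup>2) / (2 * y)" "(1 + y\<^sup>2 - w\<^sup>2) / (2 * y) \<le> 1"
    using y by (simp_all add: field_simps power2_eq_square)
qed

section \<open>Coordinates adapted to the metric\<close>

text \<open>The derivative of \<open>w_coord A\<close>, which is an affine function, in the direction \<open>\<xi>\<close>.\<close>

definition w_velocity :: "real^2^2 \<Rightarrow> real \<times> real \<Rightarrow> real" where
  "w_velocity A \<xi> = (fst \<xi> - nu A * snd \<xi>) / lam A"

locale negative_curvature =
  fixes A :: "real^2^2"
  assumes det_pos: "det A > 0"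
    and a_nonneg: "A $ 1 $ 1 \<ge> 0"
    and curvature_neg: "sectional_curvature A < 0"
begin

abbreviation "a \<equiv> A $ 1 $ 1"
abbreviation "b \<equiv> A $ 1 $ 2"
abbreviation "c \<equiv> A $ 2 $ 1"
abbreviation "d \<equiv> A $ 2 $ 2"

lemma det_eq: "det A = a * d - b * c"
  by (simp add: det_2)

lemma abs_c_less_a: "\<bar>c\<bar> < a"
proof -
  have "c\<^sup>2 < a\<^sup>2"
    using curvature_neg det_pos by (simp add: sectional_curvature_eq divide_less_0_iff)
  then show ?thesis
    using a_nonneg power2_less_imp_less[of "\<bar>c\<bar>" a] by simp
qed

lemma sum_pos: "a + c > 0" and diff_pos: "a - c > 0"
  using abs_c_less_a by auto

lemma Delta_sq: "(Delta A)\<^sup>2 = ((a + c) * (a - c)) / (det A)\<^sup>2"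
proof -
  have "(Delta A)\<^sup>2 = - ((c\<^sup>2 - a\<^sup>2) / (det A)\<^sup>2)"
    using Delta_squared[OF _ curvature_neg] det_pos by (simp add: sectional_curvature_eq)
  also have "\<dots> = ((a + c) * (a - c)) / (det A)\<^sup>2"
    by (simp add: power2_eq_square algebra_simps diff_divide_distrib)
  finally show ?thesis .
qed

lemma Delta_pos: "Delta A > 0"
proof -
  have "(Delta A)\<^sup>2 > 0"
    unfolding Delta_sq using sum_pos diff_pos det_pos by simp
  moreover have "Delta A \<ge> 0"
  proof -
    have "(matrix_inv A $ 2 $ 2)\<^sup>2 - (matrix_inv A $ 2 $ 1)\<^sup>2 \<ge> 0"
      using det_pos mult_pos_pos[OF sum_pos diff_pos]
      by (simp add: matrix_inv_2x2 power_divide power2_eq_square algebra_simps flip: diff_divide_distrib)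
    then show ?thesis
      by (simp add: Delta_def Let_def)
  qed
  ultimately show ?thesis
    by (simp add: less_le)
qed

lemma lam_eq: "lam A = det A / ((a + c) * (a - c))"
proof -
  have "lam A = (det A / (det A)\<^sup>2) / (Delta A)\<^sup>2"
    using det_pos by (simp add: lam_def Let_def matrix_inv_2x2 det_2 power2_eq_square mult.commute
        flip: diff_divide_distrib)
  then show ?thesis
    unfolding Delta_sq using det_pos sum_pos diff_pos by simp
qed

lemma nu_eq: "nu A = (c * d - a * b) / ((a + c) * (a - c))"
proof -
  have "nu A = ((c * d - a * b) / (det A)\<^sup>2) / (Delta A)\<^sup>2"
    using det_pos by (simp add: nu_def Let_def matrix_inv_2x2 power2_eq_square algebra_simps
        flip: diff_divide_distrib add_divide_distrib)
  then show ?thesis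
    unfolding Delta_sq using det_pos sum_pos diff_pos by simp
qed

lemma lam_pos: "lam A > 0"
  unfolding lam_eq using det_pos sum_pos diff_pos by simp

lemma w_quotient: "(x - nu A * y) / lam A = ((a + c) * (a - c) * x - (c * d - a * b) * y) / det A"
proof -
  have "(x - n / p * y) / (D / p) = (p * x - n * y) / D" if "p \<noteq> 0" for n p D :: real
    using that by (cases "D = 0") (simp_all add: field_simps)
  then show ?thesis
    unfolding lam_eq nu_eq using sum_pos diff_pos by simp
qed

text \<open>
  The null forms \<open>v\<^sub>2 - v\<^sub>1\<close> and \<open>v\<^sub>1 + v\<^sub>2\<close> are positive multiples of \<open>dy - dw\<close> and \<open>dy + dw\<close>.
  This is applied both to velocities and to the affine functions \<open>lam1\<close> and \<open>lam2\<close>.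
\<close>

lemma null_form1: "(c - a) * x + (d - b) * y = det A / (a + c) * (y - (x - nu A * y) / lam A)"
proof -
  have cancel: "D / s * (y - N / D) = (D * y - N) / s" if "D \<noteq> 0" for D N s :: real
    using that by (simp add: right_diff_distrib diff_divide_distrib)
  have "det A / (a + c) * (y - (x - nu A * y) / lam A)
      = (det A * y - ((a + c) * (a - c) * x - (c * d - a * b) * y)) / (a + c)"
    unfolding w_quotient using det_pos by (intro cancel) simp
  also have "det A * y - ((a + c) * (a - c) * x - (c * d - a * b) * y) = (a + c) * ((c - a) * x + (d - b) * y)"
    by (simp add: det_eq algebra_simps)
  finally show ?thesis
    using sum_pos by simp
qed

lemma null_form2: "(c + a) * x + (d + b) * y = det A / (a - c) * (y + (x - nu A * y) / lam A)"
proof -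
  have cancel: "D / s * (y + N / D) = (D * y + N) / s" if "D \<noteq> 0" for D N s :: real
    using that by (simp add: distrib_left add_divide_distrib)
  have "det A / (a - c) * (y + (x - nu A * y) / lam A)
      = (det A * y + ((a + c) * (a - c) * x - (c * d - a * b) * y)) / (a - c)"
    unfolding w_quotient using det_pos by (intro cancel) simp
  also have "det A * y + ((a + c) * (a - c) * x - (c * d - a * b) * y) = (a - c) * ((c + a) * x + (d + b) * y)"
    by (simp add: det_eq algebra_simps)
  finally show ?thesis
    using diff_pos by simp
qed

lemma lam1_eq: "lam1 A q = det A / (a + c) * (snd q - 1 - w_coord A q)"
  unfolding lam1_def w_coord_def by (rule null_form1)

lemma lam2_eq: "lam2 A q = det A / (a - c) * (snd q - 1 + w_coord A q)"
  unfolding lam2_def w_coord_def by (rule null_form2)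

text \<open>\<open>pt_B A\<close> is the point where the line \<open>lam2 = 0\<close> meets \<open>y = 0\<close>, that is \<open>(w, y) = (1, 0)\<close>.\<close>

lemma lam3_eq: "lam3 A q = det A / (a + c) * (snd q + 1 - w_coord A q)"
proof -
  have "lam2 A (pt_B A) = 0"
    unfolding lam2_def pt_B_def using sum_pos by simp
  then have "w_coord A (pt_B A) = 1"
    unfolding lam2_eq using det_pos diff_pos by (simp add: pt_B_def)
  define k where "k = det A / (a + c)"
  have "lam1 A (pt_B A) = - 2 * k"
    using \<open>w_coord A (pt_B A) = 1\<close> unfolding lam1_eq k_def[symmetric] by (simp add: pt_B_def)
  then show ?thesis
    unfolding lam3_def lam1_eq[of q] k_def[symmetric] by (simp add: algebra_simps)
qed

lemma lam1_nonneg_iff: "lam1 A q \<ge> 0 \<longleftrightarrow> w_coord A q \<le> snd q - 1"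
  unfolding lam1_eq using det_pos sum_pos by (simp add: zero_le_mult_iff zero_le_divide_iff)

lemma lam2_nonpos_iff: "lam2 A q \<le> 0 \<longleftrightarrow> w_coord A q \<le> 1 - snd q"
  unfolding lam2_eq using det_pos diff_pos by (auto simp: mult_le_0_iff divide_le_0_iff zero_le_divide_iff)

lemma lam3_neg_iff: "lam3 A q < 0 \<longleftrightarrow> w_coord A q > snd q + 1"
  unfolding lam3_eq using det_pos sum_pos by (auto simp: mult_less_0_iff divide_less_0_iff zero_less_divide_iff)

lemma lam3_zero_iff: "lam3 A q = 0 \<longleftrightarrow> w_coord A q = snd q + 1"
  unfolding lam3_eq using det_pos sum_pos by auto

lemma frame_null_coords:
  fixes \<xi> :: "real \<times> real"
  assumes "snd q > 0"
  defines "v \<equiv> A *v frame_coords q \<xi>"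
  shows "v $ 1 - v $ 2 = det A / (a + c) * ((w_velocity A \<xi> - snd \<xi>) / snd q)"
    and "v $ 1 + v $ 2 = det A / (a - c) * ((w_velocity A \<xi> + snd \<xi>) / snd q)"
proof -
  have v: "v $ 1 = (a * fst \<xi> + b * snd \<xi>) / snd q" "v $ 2 = (c * fst \<xi> + d * snd \<xi>) / snd q"
    by (simp_all add: v_def matrix_vector_mult_def sum_2 frame_coords_def add_divide_distrib)
  have "v $ 1 - v $ 2 = - ((c - a) * fst \<xi> + (d - b) * snd \<xi>) / snd q"
    unfolding v by (simp add: diff_divide_distrib[symmetric] algebra_simps)
  then show "v $ 1 - v $ 2 = det A / (a + c) * ((w_velocity A \<xi> - snd \<xi>) / snd q)"
    unfolding null_form1 w_velocity_def[symmetric] mult_minus_right[symmetric] minus_diff_eq by simp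
  have "v $ 1 + v $ 2 = ((c + a) * fst \<xi> + (d + b) * snd \<xi>) / snd q"
    unfolding v by (simp add: add_divide_distrib[symmetric] algebra_simps)
  then show "v $ 1 + v $ 2 = det A / (a - c) * ((w_velocity A \<xi> + snd \<xi>) / snd q)"
    unfolding null_form2 w_velocity_def[symmetric] by (simp add: add.commute)
qed

lemma future_nonspacelike_iff:
  assumes "snd q > 0"
  shows "future_nonspacelike A (frame_coords q \<xi>) \<longleftrightarrow> \<bar>snd \<xi>\<bar> \<le> w_velocity A \<xi>"
proof -
  define v where "v = A *v frame_coords q \<xi>"
  have sign: "0 \<le> k * (r / snd q) \<longleftrightarrow> 0 \<le> r" if "k > 0" for k r :: real
    using that assms by (simp add: zero_le_mult_iff zero_le_divide_iff)
  have k: "det A / (a + c) > 0" "det A / (a - c) > 0"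
    using det_pos sum_pos diff_pos by simp_all
  have "v $ 1 - v $ 2 \<ge> 0 \<longleftrightarrow> w_velocity A \<xi> - snd \<xi> \<ge> 0"
    unfolding v_def frame_null_coords(1)[OF assms] by (rule sign[OF k(1)])
  moreover have "v $ 1 + v $ 2 \<ge> 0 \<longleftrightarrow> w_velocity A \<xi> + snd \<xi> \<ge> 0"
    unfolding v_def frame_null_coords(2)[OF assms] by (rule sign[OF k(2)])
  ultimately show ?thesis
    unfolding future_nonspacelike_def v_def[symmetric] by (auto simp: abs_le_iff)
qed

text \<open>
  The product of the two null forms is \<open>det\<^sup>2 / (a\<^sup>2 - c\<^sup>2) = 1 / \<Delta>\<^sup>2\<close> times that of the normalized ones.
\<close>

lemma sqrt_lorentz_form:
  assumes "snd q > 0"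
  shows "sqrt (- lorentz_form A (frame_coords q \<xi>) (frame_coords q \<xi>))
    = sqrt ((w_velocity A \<xi>)\<^sup>2 - (snd \<xi>)\<^sup>2) / (Delta A * snd q)"
proof -
  define v where "v = A *v frame_coords q \<xi>"
  have "- lorentz_form A (frame_coords q \<xi>) (frame_coords q \<xi>) = (v $ 1 - v $ 2) * (v $ 1 + v $ 2)"
    by (simp add: lorentz_form_def v_def algebra_simps)
  also have "\<dots> = ((w_velocity A \<xi>)\<^sup>2 - (snd \<xi>)\<^sup>2) / ((Delta A)\<^sup>2 * (snd q)\<^sup>2)"
    unfolding v_def frame_null_coords[OF assms] Delta_sq using assms det_pos sum_pos diff_pos
    by (simp add: power2_eq_square divide_simps) (simp add: algebra_simps)
  finally show ?thesis
    using Delta_pos assms by (simp add: real_sqrt_divide real_sqrt_mult)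
qed

lemma w_coord_Id [simp]: "w_coord A aff_Id = 0"
  by (simp add: w_coord_def aff_Id_def)

lemma snd_Id [simp]: "snd aff_Id = 1"
  by (simp add: aff_Id_def)

lemma Aff_plus_iff: "q \<in> Aff_plus \<longleftrightarrow> snd q > 0"
  by (auto simp: Aff_plus_def case_prod_beta)

section \<open>Upper bounds for the length\<close>

lemma future_curve_coords:
  assumes q: "future_curve A q t0 t1"
  defines "W \<equiv> \<lambda>t. w_coord A (q t)" and "Y \<equiv> \<lambda>t. snd (q t)"
    and "\<xi> \<equiv> \<lambda>t. vector_derivative q (at t within {t0..t1})"
  shows "t0 < t1" and "\<exists>L. L-lipschitz_on {t0..t1} W" and "\<exists>L. L-lipschitz_on {t0..t1} Y"
    and "\<And>t. t \<in> {t0..t1} \<Longrightarrow> Y t > 0"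
    and "AE t in lebesgue. t \<in> {t0..t1} \<longrightarrow>
      (W has_real_derivative w_velocity A (\<xi> t)) (at t within {t0..t1}) \<and>
      (Y has_real_derivative snd (\<xi> t)) (at t within {t0..t1}) \<and> \<bar>snd (\<xi> t)\<bar> \<le> w_velocity A (\<xi> t)"
proof -
  obtain L where L: "L-lipschitz_on {t0..t1} q"
    using q by (auto simp: future_curve_def)
  have X_lip: "L-lipschitz_on {t0..t1} (\<lambda>t. fst (q t))" and Y_lip: "L-lipschitz_on {t0..t1} Y"
    unfolding Y_def using lipschitz_on_nonneg[OF L] lipschitz_onD[OF L]
    by (auto intro!: lipschitz_onI order_trans[OF dist_fst_le] order_trans[OF dist_snd_le])
  have W: "W = (\<lambda>t. (1 / lam A) * (fst (q t) - nu A * (Y t - 1)))"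
    by (simp add: W_def Y_def w_coord_def)
  have "(\<bar>1 / lam A\<bar> * (L + \<bar>nu A\<bar> * (L + 0)))-lipschitz_on {t0..t1} W"
    unfolding W by (intro lipschitz_on_cmult_real lipschitz_on_diff X_lip Y_lip lipschitz_on_constant)
  then show "\<exists>L. L-lipschitz_on {t0..t1} W" by blast
  show "\<exists>L. L-lipschitz_on {t0..t1} Y"
    using Y_lip by blast
  show "t0 < t1" and pos: "\<And>t. t \<in> {t0..t1} \<Longrightarrow> Y t > 0"
    using q by (auto simp: future_curve_def Y_def Aff_plus_iff[symmetric])
  have "AE t in lebesgue. t \<in> {t0..t1} \<longrightarrow>
        q differentiable (at t within {t0..t1}) \<and>
        future_nonspacelike A (frame_coords (q t) (\<xi> t))"
    using q by (simp add: future_curve_def \<xi>_def)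
  then show "AE t in lebesgue. t \<in> {t0..t1} \<longrightarrow>
      (W has_real_derivative w_velocity A (\<xi> t)) (at t within {t0..t1}) \<and>
      (Y has_real_derivative snd (\<xi> t)) (at t within {t0..t1}) \<and> \<bar>snd (\<xi> t)\<bar> \<le> w_velocity A (\<xi> t)"
  proof (eventually_elim, intro impI conjI)
    fix t assume *: "t \<in> {t0..t1} \<longrightarrow> q differentiable (at t within {t0..t1}) \<and>
        future_nonspacelike A (frame_coords (q t) (\<xi> t))" and t: "t \<in> {t0..t1}"
    then have "(q has_vector_derivative \<xi> t) (at t within {t0..t1})"
      unfolding \<xi>_def by (simp add: vector_derivative_works[symmetric])
    from bounded_linear.has_vector_derivative[OF bounded_linear_fst this]
      bounded_linear.has_vector_derivative[OF bounded_linear_snd this]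
    have X: "((\<lambda>t. fst (q t)) has_real_derivative fst (\<xi> t)) (at t within {t0..t1})"
      and Y: "(Y has_real_derivative snd (\<xi> t)) (at t within {t0..t1})"
      by (simp_all add: has_real_derivative_iff_has_vector_derivative Y_def)
    show "(Y has_real_derivative snd (\<xi> t)) (at t within {t0..t1})" by (rule Y)
    show "(W has_real_derivative w_velocity A (\<xi> t)) (at t within {t0..t1})"
      unfolding W w_velocity_def using lam_pos
      by (auto intro!: derivative_eq_intros X Y)
    show "\<bar>snd (\<xi> t)\<bar> \<le> w_velocity A (\<xi> t)"
      using * t pos[OF t] by (simp add: Y_def future_nonspacelike_iff)
  qed
qed

lemma future_curve_in_cone:
  assumes "future_curve A q t0 t1" "q t0 = aff_Id"
  shows "\<bar>snd (q t1) - 1\<bar> \<le> w_coord A (q t1)"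
proof -
  note C = future_curve_coords[OF assms(1)]
  obtain L L' where lip: "L-lipschitz_on {t0..t1} (\<lambda>t. w_coord A (q t))"
    "L'-lipschitz_on {t0..t1} (\<lambda>t. snd (q t))"
    using C by blast
  have "w_coord A (q t0) + snd (q t0) \<le> w_coord A (q t1) + snd (q t1)"
    by (rule lipschitz_mono_if_deriv_nonneg[OF lipschitz_on_add[OF lip]],
        use C(5) in eventually_elim) (use C(1) in \<open>auto intro!: derivative_eq_intros\<close>)
  moreover have "w_coord A (q t0) - snd (q t0) \<le> w_coord A (q t1) - snd (q t1)"
    by (rule lipschitz_mono_if_deriv_nonneg[OF lipschitz_on_diff[OF lip]],
        use C(5) in eventually_elim) (use C(1) in \<open>auto intro!: derivative_eq_intros\<close>)
  ultimately show ?thesis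
    using assms(2) by (auto simp: abs_le_iff)
qed

lemma lorentz_length_le:
  assumes q: "future_curve A q t0 t1" "q t0 = aff_Id"
    and w0: "\<bar>w0\<bar> \<le> 1" "\<bar>w_coord A (q t1) - w0\<bar> \<le> snd (q t1)"
  shows "lorentz_length A q t0 t1
    \<le> ennreal ((arcsin ((w_coord A (q t1) - w0) / snd (q t1)) + arcsin w0) / Delta A)"
proof -
  note C = future_curve_coords[OF q(1)]
  obtain L L' where lip: "L-lipschitz_on {t0..t1} (\<lambda>t. w_coord A (q t))"
    "L'-lipschitz_on {t0..t1} (\<lambda>t. snd (q t))"
    using C by blast
  define \<xi> where "\<xi> t = vector_derivative q (at t within {t0..t1})" for t
  have "lorentz_length A q t0 t1 = (\<integral>\<^sup>+ t\<in>{t0..t1}.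
      ennreal (sqrt ((w_velocity A (\<xi> t))\<^sup>2 - (snd (\<xi> t))\<^sup>2) / (Delta A * snd (q t))) \<partial>lebesgue)"
    unfolding lorentz_length_def Let_def \<xi>_def[symmetric]
    by (intro nn_integral_cong) (auto simp: indicator_def sqrt_lorentz_form C(4))
  also have "\<dots> \<le> ennreal ((arcsin ((w_coord A (q t1) - w0) / snd (q t1))
      - arcsin ((w_coord A (q t0) - w0) / snd (q t0))) / Delta A)"
    using q(2) w0 C(4)
    by (intro causal_length_le_arcsin_diff[OF Delta_pos C(1) lip _ C(5)[folded \<xi>_def]])
       auto
  also have "arcsin ((w_coord A (q t0) - w0) / snd (q t0)) = - arcsin w0"
    using q(2) w0 arcsin_minus[of w0] by (simp add: abs_le_iff)
  finally show ?thesis by simp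
qed


section \<open>Curves that are almost longest\<close>

text \<open>
  The function \<open>M\<close> is the middle piece of a curve parametrized by \<open>w\<close>; the condition on \<open>M\<close> at
  \<open>s0\<close> and \<open>s1\<close> makes it fit to the null lines through the two end points.  Only the
  length of the middle piece is counted, since the null pieces have none, and \<open>G\<close> is an
  antiderivative of a lower bound for its speed in the model.
\<close>

lemma graph_curve_dist_ge:
  fixes M M' G G' :: "real \<Rightarrow> real"
  assumes q1: "q1 \<in> Aff_plus"
    and s: "0 \<le> s0" "s0 < s1" "s1 \<le> w_coord A q1"
    and M: "\<And>t. t \<in> {s0..s1} \<Longrightarrow> (M has_real_derivative M' t) (at t within {s0..s1})"
    and M'_le: "\<And>t. t \<in> {s0..s1} \<Longrightarrow> \<bar>M' t\<bar> \<le> 1"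
    and M_pos: "\<And>t. t \<in> {s0..s1} \<Longrightarrow> M t > 0"
    and ends: "M s0 = 1 - s0" "M s1 = s1 - w_coord A q1 + snd q1"
    and G: "\<And>t. t \<in> {s0..s1} \<Longrightarrow> (G has_real_derivative G' t) (at t within {s0..s1})"
    and G'_le: "\<And>t. t \<in> {s0..s1} \<Longrightarrow> 0 \<le> G' t \<and> G' t \<le> sqrt (1 - (M' t)\<^sup>2) / M t"
  shows "ennreal ((G s1 - G s0) / Delta A) \<le> lorentz_dist A aff_Id q1"
proof -
  define w1 y1 where "w1 = w_coord A q1" and "y1 = snd q1"
  note w1 = w1_def[symmetric] and y1 = y1_def[symmetric]
  have w1_pos: "0 < w1" using s by (simp add: w1)
  define Y where "Y t = (if t \<le> s0 then 1 - t else if t \<le> s1 then M t else t - w1 + y1)" for t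
  define Y' where "Y' t = (if t < s0 then - 1 else if t < s1 then M' t else 1)" for t
  have Y'_le: "\<bar>Y' t\<bar> \<le> 1" for t
    using M'_le[of t] by (auto simp: Y'_def)
  have Y_pos: "Y t > 0" for t
    using M_pos[of s0] M_pos[of s1] M_pos[of t] s ends by (auto simp: Y_def w1 y1)
  have M_lip: "1-lipschitz_on {s0..s1} M"
  proof (rule lipschitz_onI)
    show "dist (M x) (M y) \<le> 1 * dist x y" if "x \<in> {s0..s1}" "y \<in> {s0..s1}" for x y
      unfolding dist_norm using M'_le that
      by (intro field_differentiable_bound[OF _ M]) auto
  qed simp
  have "1-lipschitz_on {s0..w1} (\<lambda>t. if t \<le> s1 then M t else t - w1 + y1)"
    by (rule lipschitz_on_concat[OF M_lip]) (auto simp: ends w1 y1 lipschitz_on_def dist_real_def)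
  moreover have "1-lipschitz_on {0..s0} (\<lambda>t. 1 - t)"
    by (auto simp: lipschitz_on_def dist_real_def)
  ultimately have Y_lip: "1-lipschitz_on {0..w1} Y"
    unfolding Y_def using s ends(1) by (intro lipschitz_on_concat[where b = s0]) auto
  have Y_deriv: "(Y has_real_derivative Y' t) (at t)" if t: "t \<notin> {s0, s1}" for t
  proof -
    consider "t < s0" | "s0 < t" "t < s1" | "s1 < t"
      using t by (metis insertCI linorder_neqE_linordered_idom)
    then show ?thesis
    proof cases
      case 1
      have "((\<lambda>t. 1 - t) has_real_derivative - 1) (at t)"
        by (auto intro!: derivative_eq_intros)
      then have "(Y has_real_derivative - 1) (at t)"
        by (rule has_field_derivative_transform_within_open[of _ _ _ "{..<s0}"]) (use 1 in \<open>auto simp: Y_def\<close>)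
      then show ?thesis using 1 by (simp add: Y'_def)
    next
      case 2
      then have "(M has_real_derivative M' t) (at t)"
        using M[of t] by (simp add: at_within_Icc_at)
      then have "(Y has_real_derivative M' t) (at t)"
        by (rule has_field_derivative_transform_within_open[of _ _ _ "{s0<..<s1}"]) (use 2 in \<open>auto simp: Y_def\<close>)
      then show ?thesis using 2 by (simp add: Y'_def)
    next
      case 3
      have "((\<lambda>t. t - w1 + y1) has_real_derivative 1) (at t)"
        by (auto intro!: derivative_eq_intros)
      then have "(Y has_real_derivative 1) (at t)"
        by (rule has_field_derivative_transform_within_open[of _ _ _ "{s1<..}"]) (use 3 s in \<open>auto simp: Y_def\<close>)
      then show ?thesis using 3 s by (simp add: Y'_def)
    qed
  qed
  define q where "q t = (lam A * t + nu A * (Y t - 1), Y t)" for t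
  define \<xi> where "\<xi> t = (lam A + nu A * Y' t, Y' t)" for t
  have q_deriv: "(q has_vector_derivative \<xi> t) (at t within {0..w1})" if "t \<notin> {s0, s1}" for t
  proof -
    have "((\<lambda>t. lam A * t + nu A * (Y t - 1)) has_vector_derivative (lam A + nu A * Y' t)) (at t within {0..w1})"
      unfolding has_real_derivative_iff_has_vector_derivative[symmetric]
      by (auto intro!: derivative_eq_intros DERIV_subset[OF Y_deriv[OF that]])
    moreover have "(Y has_vector_derivative Y' t) (at t within {0..w1})"
      unfolding has_real_derivative_iff_has_vector_derivative[symmetric]
      by (rule DERIV_subset[OF Y_deriv[OF that]]) simp
    ultimately show ?thesis
      unfolding q_def \<xi>_def by (rule has_vector_derivative_Pair)
  qed
  have \<xi>_eq: "vector_derivative q (at t within {0..w1}) = \<xi> t" if "t \<in> {0..w1} - {s0, s1}" for t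
    using that w1_pos vector_derivative_within_cbox[of 0 w1 t q "\<xi> t"] q_deriv[of t] by simp
  have w_vel: "w_velocity A (\<xi> t) = 1" for t
    using lam_pos by (simp add: w_velocity_def \<xi>_def)
  have AE_off: "AE t in lebesgue. t \<notin> {s0, s1}"
    unfolding eventually_ae_filter_negligible by (intro exI[of _ "{s0, s1}"]) auto
  have "future_curve A q 0 w1"
    unfolding future_curve_def
  proof (intro conjI)
    show "q ` {0..w1} \<subseteq> Aff_plus"
      using Y_pos by (auto simp: q_def Aff_plus_def)
    have "(sqrt ((\<bar>lam A\<bar> * 1 + \<bar>nu A\<bar> * (1 + 0))\<^sup>2 + 1\<^sup>2))-lipschitz_on {0..w1} q"
      unfolding q_def
      by (intro lipschitz_on_Pair lipschitz_on_add lipschitz_on_diff lipschitz_on_cmult_real Y_lip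
          lipschitz_on_id lipschitz_on_constant)
    then show "\<exists>L. L-lipschitz_on {0..w1} q" by blast
    show "AE t in lebesgue. t \<in> {0..w1} \<longrightarrow> q differentiable at t within {0..w1} \<and>
      future_nonspacelike A (frame_coords (q t) (vector_derivative q (at t within {0..w1})))"
      using AE_off
    proof (eventually_elim, intro impI conjI)
      fix t assume t: "t \<notin> {s0, s1}" "t \<in> {0..w1}"
      show "q differentiable at t within {0..w1}"
        using q_deriv[OF t(1)] by (rule differentiableI_vector)
      have "future_nonspacelike A (frame_coords (q t) (\<xi> t))"
        using Y'_le[of t] Y_pos[of t]
        by (subst future_nonspacelike_iff) (simp_all add: w_vel, simp_all add: q_def \<xi>_def)
      then show "future_nonspacelike A (frame_coords (q t) (vector_derivative q (at t within {0..w1})))"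
        using t by (simp add: \<xi>_eq)
    qed
  qed (rule w1_pos)
  moreover have "q 0 = aff_Id"
    using s ends by (auto simp: q_def Y_def aff_Id_def)
  moreover have "q w1 = q1"
  proof -
    have Yw: "Y w1 = y1" using s ends by (auto simp: Y_def w1 y1)
    have "lam A * w1 + nu A * (y1 - 1) = fst q1"
      using lam_pos by (simp add: w1_def y1_def w_coord_def)
    then show ?thesis by (simp add: q_def Yw y1_def)
  qed
  ultimately have dist_ge: "lorentz_length A q 0 w1 \<le> lorentz_dist A aff_Id q1"
    unfolding lorentz_dist_def by (intro Sup_upper) blast
  have "((\<lambda>t. G' t / Delta A) has_integral (G s1 - G s0) / Delta A) {s0..s1}"
    by (intro has_integral_divide fundamental_theorem_of_calculus)
       (use s G in \<open>auto simp: has_real_derivative_iff_has_vector_derivative\<close>)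
  then have "(\<integral>\<^sup>+ t. ennreal (G' t / Delta A) * indicator {s0..s1} t \<partial>lborel)
      = ennreal ((G s1 - G s0) / Delta A)"
    by (rule nn_integral_has_integral_lebesgue'[rotated]) (use G'_le Delta_pos in auto)
  then have "ennreal ((G s1 - G s0) / Delta A)
      = (\<integral>\<^sup>+ t. ennreal (G' t / Delta A) * indicator {s0..s1} t \<partial>lebesgue)"
    by (simp add: nn_integral_completion)
  also have "\<dots> \<le> lorentz_length A q 0 w1"
    unfolding lorentz_length_def Let_def
  proof (rule nn_integral_mono_AE, use AE_off in eventually_elim)
    fix t assume t: "t \<notin> {s0, s1}"
    show "ennreal (G' t / Delta A) * indicator {s0..s1} t
      \<le> ennreal (sqrt (- lorentz_form A (frame_coords (q t) (vector_derivative q (at t within {0..w1})))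
          (frame_coords (q t) (vector_derivative q (at t within {0..w1}))))) * indicator {0..w1} t"
    proof (cases "t \<in> {s0..s1}")
      case True
      then have t': "s0 < t" "t < s1" "t \<in> {0..w1}" using t s by (auto simp: w1)
      have YM: "Y t = M t" "Y' t = M' t" using t' by (auto simp: Y_def Y'_def)
      have "sqrt (- lorentz_form A (frame_coords (q t) (\<xi> t)) (frame_coords (q t) (\<xi> t)))
        = sqrt (1 - (M' t)\<^sup>2) / (Delta A * M t)"
        using Y_pos[of t] by (simp add: sqrt_lorentz_form q_def w_vel YM) (simp add: \<xi>_def YM)
      moreover have "G' t / Delta A \<le> sqrt (1 - (M' t)\<^sup>2) / (Delta A * M t)"
        using G'_le[OF True] Delta_pos divide_right_mono[of "G' t" "sqrt (1 - (M' t)\<^sup>2) / M t" "Delta A"]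
        by (simp add: mult.commute)
      ultimately show ?thesis
        using True t t' by (simp add: \<xi>_eq ennreal_leI)
    qed simp
  qed
  finally show ?thesis using dist_ge by simp
qed


section \<open>The distance from the identity\<close>

definition sigma :: "point \<Rightarrow> real" where
  "sigma q = arccos ((1 + (snd q)\<^sup>2 - (w_coord A q)\<^sup>2) / (2 * snd q))"

lemma dist_outside_cone:
  assumes "w_coord A q1 < \<bar>snd q1 - 1\<bar>"
  shows "lorentz_dist A aff_Id q1 = 0"
proof -
  have "{lorentz_length A q t0 t1 | q t0 t1. future_curve A q t0 t1 \<and> q t0 = aff_Id \<and> q t1 = q1} = {}"
    using future_curve_in_cone assms by fastforce
  then show ?thesis
    unfolding lorentz_dist_def by (simp only: Sup_empty bot_ennreal)
qed

lemma dist_le_sigma: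
  assumes q1: "q1 \<in> Aff_plus" and w: "\<bar>snd q1 - 1\<bar> \<le> w_coord A q1" "w_coord A q1 \<le> snd q1 + 1"
  shows "lorentz_dist A aff_Id q1 \<le> ennreal (sigma q1 / Delta A)"
  unfolding lorentz_dist_def
proof (rule Sup_least, clarify)
  fix q t0 t1 assume q: "future_curve A q t0 t1" "q t0 = aff_Id" "q1 = q t1"
  have y: "snd q1 > 0" using q1 by (simp add: Aff_plus_iff)
  show "lorentz_length A q t0 t1 \<le> ennreal (sigma (q t1) / Delta A)"
  proof (cases "w_coord A q1 = 0")
    case True
    then have "snd q1 = 1" using w by simp
    then show ?thesis
      using lorentz_length_le[OF q(1,2), of 0] True q(3) by (simp add: sigma_def)
  next
    case False
    then have "w_coord A q1 > 0" using w by linarith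
    note c = arcsin_add_arcsin_center[OF y w this]
    show ?thesis
      using lorentz_length_le[OF q(1,2), folded q(3), OF c(1,2)]
      unfolding c(3) sigma_def q(3)[symmetric] .
  qed
qed

lemma dist_ge_sigma:
  assumes q1: "q1 \<in> Aff_plus" and w: "\<bar>snd q1 - 1\<bar> < w_coord A q1" "w_coord A q1 < snd q1 + 1"
  shows "ennreal (sigma q1 / Delta A) \<le> lorentz_dist A aff_Id q1"
proof -
  define w1 y1 where "w1 = w_coord A q1" and "y1 = snd q1"
  have y1: "y1 > 0" using q1 by (simp add: Aff_plus_iff y1_def)
  have w1: "\<bar>y1 - 1\<bar> < w1" "w1 < y1 + 1" "w1 > 0" using w by (auto simp: w1_def y1_def)
  define w0 where "w0 = (1 + w1\<^sup>2 - y1\<^sup>2) / (2 * w1)"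
  have w0: "2 * w1 * w0 = 1 + w1\<^sup>2 - y1\<^sup>2"
    using w1 by (simp add: w0_def)
  have "\<bar>w0\<bar> < 1"
  proof -
    have "(w1 - 1)\<^sup>2 < y1\<^sup>2" "y1\<^sup>2 < (w1 + 1)\<^sup>2"
      using w1 y1 power_strict_mono[of "\<bar>w1 - 1\<bar>" y1 2] power_strict_mono[of y1 "w1 + 1" 2] by auto
    then have "2 * w1 * w0 < 2 * w1 * 1" "2 * w1 * (- 1) < 2 * w1 * w0"
      unfolding w0 by (simp_all add: power2_eq_square algebra_simps)
    then have "w0 < 1" "- 1 < w0"
      using w1(3) mult_left_less_imp_less[of "2 * w1" w0 1] mult_left_less_imp_less[of "2 * w1" "- 1" w0]
      by linarith+
    then show ?thesis by simp
  qed
  then have w0_sq: "w0\<^sup>2 < 1" by (simp add: abs_square_less_1)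
  define r where "r = sqrt (1 - w0\<^sup>2)"
  have r: "r > 0" "r\<^sup>2 = 1 - w0\<^sup>2" using w0_sq by (simp_all add: r_def)
  define M where "M t = sqrt (r\<^sup>2 + (t - w0)\<^sup>2)" for t
  have pos: "r\<^sup>2 + (t - w0)\<^sup>2 > 0" for t using r(1) by (simp add: add_pos_nonneg)
  have M_pos: "M t > 0" for t using pos by (simp add: M_def)
  have M_sq: "(M t)\<^sup>2 = r\<^sup>2 + (t - w0)\<^sup>2" for t using pos[of t] by (simp add: M_def)
  have M0: "M 0 = 1" by (simp add: M_def r)
  have Mw: "M w1 = y1"
  proof -
    have "r\<^sup>2 + (w1 - w0)\<^sup>2 = y1\<^sup>2"
      unfolding r(2) using w0 by (simp add: power2_eq_square algebra_simps)
    then show ?thesis using y1 by (simp add: M_def)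
  qed
  \<comment> \<open>The speed of the geodesic is \<open>r / (M t)\<^sup>2\<close>, the derivative of \<open>G\<close>.\<close>
  define G where "G t = arctan ((t - w0) / r)" for t
  have "ennreal ((G w1 - G 0) / Delta A) \<le> lorentz_dist A aff_Id q1"
  proof (rule graph_curve_dist_ge[OF q1, of 0 w1 M "\<lambda>t. (t - w0) / M t" G "\<lambda>t. r / (M t)\<^sup>2"])
    fix t
    show "(M has_real_derivative (t - w0) / M t) (at t within {0..w1})"
      unfolding M_def using pos[of t] by (auto intro!: derivative_eq_intros simp: divide_simps)
    have "\<bar>t - w0\<bar> \<le> M t"
      unfolding M_def by (rule real_le_rsqrt) simp
    then show "\<bar>(t - w0) / M t\<bar> \<le> 1"
      using M_pos[of t] by (simp add: abs_divide)
    show "M t > 0" by (rule M_pos)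
    have "1 + ((t - w0) / r)\<^sup>2 = (M t)\<^sup>2 / r\<^sup>2"
      unfolding M_sq using r(1) by (simp add: power_divide add_divide_distrib)
    then show "(G has_real_derivative r / (M t)\<^sup>2) (at t within {0..w1})"
      unfolding G_def using r(1) M_pos[of t]
      by (auto intro!: derivative_eq_intros simp: field_simps power2_eq_square)
    have "1 - ((t - w0) / M t)\<^sup>2 = ((M t)\<^sup>2 - (t - w0)\<^sup>2) / (M t)\<^sup>2"
      unfolding power_divide using M_pos[of t] by (simp add: diff_divide_distrib)
    then have "1 - ((t - w0) / M t)\<^sup>2 = (r / M t)\<^sup>2"
      using M_sq[of t] by (simp add: power_divide)
    then have "sqrt (1 - ((t - w0) / M t)\<^sup>2) = r / M t"
      using M_pos[of t] r(1) by simp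
    then have "sqrt (1 - ((t - w0) / M t)\<^sup>2) / M t = r / (M t)\<^sup>2"
      by (simp add: power2_eq_square)
    then show "0 \<le> r / (M t)\<^sup>2 \<and> r / (M t)\<^sup>2 \<le> sqrt (1 - ((t - w0) / M t)\<^sup>2) / M t"
      using r by simp
  qed (use w1 M0 Mw in \<open>simp_all add: w1_def y1_def\<close>)
  also have "G w1 - G 0 = arcsin ((w1 - w0) / y1) + arcsin w0"
  proof -
    have arcsin: "arcsin (u / M t) = arctan (u / r)" if "u = t - w0" for u t
    proof -
      have M: "(M t)\<^sup>2 = r\<^sup>2 + u\<^sup>2" using M_sq that by simp
      have "\<bar>u\<bar> < M t"
        using M_pos[of t] r(1) M by (intro power2_less_imp_less[of "\<bar>u\<bar>"]) auto
      then have u: "- 1 < u / M t" "u / M t < 1"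
        using M_pos[of t] by (auto simp: field_simps)
      have "sqrt (1 - (u / M t)\<^sup>2) = r / M t"
        using M_pos[of t] M r by (intro real_sqrt_unique) (auto simp: power_divide field_simps)
      then show ?thesis
        using arcsin_arctan[OF u] M_pos[of t] r by simp
    qed
    show ?thesis
      using arcsin[of "w1 - w0" w1] arcsin[of "- w0" 0] \<open>\<bar>w0\<bar> < 1\<close>
      by (simp add: G_def M0 Mw arcsin_minus)
  qed
  also have "\<dots> = sigma q1"
    using arcsin_add_arcsin_center[of y1 w1] y1 w1 by (simp add: sigma_def w0_def w1_def y1_def)
  finally show ?thesis .
qed

text \<open>
  The null lines through the two end points meet the line \<open>y = e\<close> at \<open>w = 1 - e\<close> and
  \<open>w = w1 - y1 + e\<close>; the segment between them has length at least \<open>(w1 - y1 - 1) / (e \<Delta>)\<close>.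
\<close>

lemma dist_beyond_F:
  assumes q1: "q1 \<in> Aff_plus" and w: "snd q1 + 1 < w_coord A q1"
  shows "lorentz_dist A aff_Id q1 = \<infinity>"
proof -
  define w1 y1 where "w1 = w_coord A q1" and "y1 = snd q1"
  have y1: "y1 > 0" using q1 by (simp add: Aff_plus_iff y1_def)
  have w1: "y1 + 1 < w1" using w by (auto simp: w1_def y1_def)
  have ge: "ennreal ((w1 - y1 - 1) / (e * Delta A)) \<le> lorentz_dist A aff_Id q1"
    if e: "0 < e" "e < 1" "e < y1" for e
  proof -
    have "ennreal (((w1 - y1 + e) / e - (1 - e) / e) / Delta A) \<le> lorentz_dist A aff_Id q1"
    proof (rule graph_curve_dist_ge[OF q1, of "1 - e" "w1 - y1 + e" "\<lambda>_. e" "\<lambda>_. 0" "\<lambda>t. t / e" "\<lambda>_. 1 / e"])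
      show "((\<lambda>t. t / e) has_real_derivative 1 / e) (at t within {1 - e..w1 - y1 + e})" for t
        using e by (auto intro!: derivative_eq_intros)
    qed (use e w1 y1 in \<open>simp_all add: w1_def y1_def\<close>)
    moreover have "(w1 - y1 - 1) / (e * Delta A) \<le> ((w1 - y1 + e) / e - (1 - e) / e) / Delta A"
      using e Delta_pos by (simp add: divide_simps)
    ultimately show ?thesis
      using ennreal_leI order_trans by blast
  qed
  have "ennreal r \<le> lorentz_dist A aff_Id q1" for r
  proof -
    define k where "k = (w1 - y1 - 1) / Delta A"
    have k: "k > 0" using w1 Delta_pos by (simp add: k_def)
    \<comment> \<open>The height \<open>e\<close> must lie below both end points, and be so small that the length exceeds \<open>r\<close>.\<close>
    define e where "e = min (min (1 / 2) (y1 / 2)) (k / max 1 r)"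
    have e: "0 < e" "e < 1" "e < y1" "e \<le> k / max 1 r"
      using y1 k by (auto simp: e_def)
    have "r \<le> k / e"
    proof -
      have "r * e \<le> max 1 r * e" using e by (intro mult_right_mono) auto
      also have "\<dots> \<le> k"
        using e(4) pos_le_divide_eq[of "max 1 r" e k] by (simp only: mult.commute)
      finally show ?thesis
        using e by (simp add: pos_le_divide_eq)
    qed
    also have "k / e = (w1 - y1 - 1) / (e * Delta A)" by (simp add: k_def)
    finally show ?thesis
      using ge[OF e(1-3)] ennreal_leI order_trans by blast
  qed
  then have "of_nat n \<le> lorentz_dist A aff_Id q1" for n
    by (metis ennreal_of_nat_eq_real_of_nat)
  then show ?thesis
    by (metis infinity_ennreal_def ennreal_Ex_less_of_nat linorder_not_less top.not_eq_extremum)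
qed

text \<open>
  Here the two null lines meet at \<open>(1, 0)\<close>.  The corner is cut by the arc
  \<open>y\<^sup>2 = r\<^sup>2 + k\<^sup>2 (w - 1)\<^sup>2\<close> with \<open>k = sin \<phi>\<close>: for \<open>k = 1\<close> it would be a geodesic with the null lines as
  asymptotes, of total length \<open>\<pi> / \<Delta>\<close>, but only for \<open>k < 1\<close> does it meet them, and \<open>r = S cos \<phi>\<close>
  makes it do so at \<open>w = 1 \<plusminus> S\<close>.  Its length is at least \<open>2 \<phi> / \<Delta>\<close>.
\<close>

lemma dist_on_F_ge:
  assumes q1: "q1 \<in> Aff_plus" and w: "w_coord A q1 = snd q1 + 1"
  shows "ennreal (pi / Delta A) \<le> lorentz_dist A aff_Id q1"
proof -
  define y1 where "y1 = snd q1"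
  have y1: "y1 > 0" using q1 by (simp add: Aff_plus_iff y1_def)
  define S where "S = min 1 y1 / 2"
  have S: "0 < S" "S < 1" "S < y1" using y1 by (auto simp: S_def)
  have ge: "ennreal (2 * \<phi> / Delta A) \<le> lorentz_dist A aff_Id q1" if \<phi>: "0 < \<phi>" "\<phi> < pi / 2" for \<phi>
  proof -
    define k where "k = sin \<phi>"
    define r where "r = S * cos \<phi>"
    have cos: "cos \<phi> > 0" and k: "0 < k" "k \<le> 1"
      using \<phi> by (auto simp: k_def cos_gt_zero sin_gt_zero)
    have r: "r > 0" using cos S by (simp add: r_def)
    define M where "M t = sqrt (r\<^sup>2 + k\<^sup>2 * (t - 1)\<^sup>2)" for t
    have pos: "r\<^sup>2 + k\<^sup>2 * (t - 1)\<^sup>2 > 0" for t using r by (simp add: add_pos_nonneg)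
    have M_pos: "M t > 0" for t using pos by (simp add: M_def)
    have M_sq: "(M t)\<^sup>2 = r\<^sup>2 + k\<^sup>2 * (t - 1)\<^sup>2" for t using pos[of t] by (simp add: M_def)
    have "r\<^sup>2 + k\<^sup>2 * S\<^sup>2 = S\<^sup>2 * ((sin \<phi>)\<^sup>2 + (cos \<phi>)\<^sup>2)"
      unfolding r_def k_def by algebra
    then have M_ends: "M (1 - S) = S" "M (1 + S) = S"
      using S by (simp_all add: M_def)
    define G where "G t = arctan (k * (t - 1) / r) / k" for t
    have "ennreal ((G (1 + S) - G (1 - S)) / Delta A) \<le> lorentz_dist A aff_Id q1"
    proof (rule graph_curve_dist_ge[OF q1, of "1 - S" "1 + S" M "\<lambda>t. k\<^sup>2 * (t - 1) / M t" G "\<lambda>t. r / (M t)\<^sup>2"])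
      fix t
      show "(M has_real_derivative k\<^sup>2 * (t - 1) / M t) (at t within {1 - S..1 + S})"
        unfolding M_def using pos[of t] by (auto intro!: derivative_eq_intros simp: divide_simps)
      show "M t > 0" by (rule M_pos)
      have "1 + (k * (t - 1) / r)\<^sup>2 = (M t)\<^sup>2 / r\<^sup>2"
        unfolding M_sq using r by (simp add: power_divide power_mult_distrib add_divide_distrib)
      then show "(G has_real_derivative r / (M t)\<^sup>2) (at t within {1 - S..1 + S})"
        unfolding G_def using r k M_pos[of t]
        by (auto intro!: derivative_eq_intros simp: field_simps power2_eq_square)
      have "k\<^sup>2 \<le> 1" using k by (simp add: power_le_one)
      have "(r / M t)\<^sup>2 \<le> 1 - (k\<^sup>2 * (t - 1) / M t)\<^sup>2"
      proof -
        have "(k\<^sup>2 * (t - 1))\<^sup>2 = k\<^sup>2 * (k\<^sup>2 * (t - 1)\<^sup>2)"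
          by (simp add: power2_eq_square)
        also have "\<dots> \<le> k\<^sup>2 * (t - 1)\<^sup>2"
          using \<open>k\<^sup>2 \<le> 1\<close> by (intro mult_left_mono mult_left_le_one_le) auto
        finally have "r\<^sup>2 + (k\<^sup>2 * (t - 1))\<^sup>2 \<le> (M t)\<^sup>2" by (simp add: M_sq)
        then show ?thesis
          using M_pos[of t] by (simp add: power_divide field_simps)
      qed
      moreover from this have "(k\<^sup>2 * (t - 1) / M t)\<^sup>2 \<le> 1"
        using zero_le_power2[of "r / M t"] by linarith
      ultimately show "\<bar>k\<^sup>2 * (t - 1) / M t\<bar> \<le> 1"
        by (simp add: abs_square_le_1)
      have "r / M t \<le> sqrt (1 - (k\<^sup>2 * (t - 1) / M t)\<^sup>2)"
        using \<open>(r / M t)\<^sup>2 \<le> _\<close> by (rule real_le_rsqrt)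
      then have "r / M t / M t \<le> sqrt (1 - (k\<^sup>2 * (t - 1) / M t)\<^sup>2) / M t"
        using M_pos[of t] by (intro divide_right_mono) auto
      then show "0 \<le> r / (M t)\<^sup>2 \<and> r / (M t)\<^sup>2 \<le> sqrt (1 - (k\<^sup>2 * (t - 1) / M t)\<^sup>2) / M t"
        using r by (simp add: power2_eq_square)
    qed (use S M_ends w in \<open>simp_all add: y1_def\<close>)
    moreover have "2 * \<phi> \<le> G (1 + S) - G (1 - S)"
    proof -
      have "arctan (k * S / r) = \<phi>"
        using S \<phi> arctan_tan[of \<phi>] by (simp add: k_def r_def tan_def)
      then have "G (1 + S) - G (1 - S) = 2 * \<phi> / k"
        by (simp add: G_def arctan_minus)
      moreover have "2 * \<phi> \<le> 2 * \<phi> / k"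
        using k \<phi> by (simp add: field_simps mult_left_le)
      ultimately show ?thesis by simp
    qed
    ultimately show ?thesis
      using Delta_pos by (meson ennreal_leI order_trans divide_right_mono less_imp_le)
  qed
  have "((\<lambda>\<phi>. ennreal (2 * \<phi> / Delta A)) \<longlongrightarrow> ennreal (2 * (pi / 2) / Delta A)) (at_left (pi / 2))"
    using Delta_pos by (intro tendsto_ennrealI tendsto_intros) auto
  moreover have "\<forall>\<^sub>F \<phi> in at_left (pi / 2). ennreal (2 * \<phi> / Delta A) \<le> lorentz_dist A aff_Id q1"
    using eventually_at_left_real[of 0 "pi / 2"] by (auto elim!: eventually_mono intro: ge)
  ultimately show ?thesis
    using tendsto_upperbound[of _ "ennreal (2 * (pi / 2) / Delta A)" "at_left (pi / 2)"] by simp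
qed


text \<open>
  Expanding the square shows that the equation of the hyperbola is the equation for \<open>cos s\<close>
  that defines \<open>sigma\<close>, multiplied by \<open>2 y\<close>.
\<close>

lemma sigma_eq_iff:
  assumes q: "q \<in> Aff_plus" and s: "0 \<le> s" "s \<le> pi"
    and w: "\<bar>snd q - 1\<bar> \<le> w_coord A q" "w_coord A q \<le> snd q + 1"
  shows "sigma q = s \<longleftrightarrow> (w_coord A q)\<^sup>2 - (snd q - cos s)\<^sup>2 = (sin s)\<^sup>2"
proof -
  define C where "C = (1 + (snd q)\<^sup>2 - (w_coord A q)\<^sup>2) / (2 * snd q)"
  have y: "snd q > 0" using q by (simp add: Aff_plus_iff)
  have C: "- 1 \<le> C" "C \<le> 1"
    using cos_ratio_bounds[OF y w] by (simp_all add: C_def)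
  have "sigma q = s \<longleftrightarrow> C = cos s"
    using C s by (auto simp: sigma_def C_def[symmetric] arccos_cos cos_arccos)
  also have "\<dots> \<longleftrightarrow> 1 + (snd q)\<^sup>2 - (w_coord A q)\<^sup>2 = 2 * snd q * cos s"
    using y by (simp add: C_def field_simps)
  also have "\<dots> \<longleftrightarrow> (w_coord A q)\<^sup>2 - (snd q - cos s)\<^sup>2 = (sin s)\<^sup>2"
    using sin_cos_squared_add[of s] by (auto simp: power2_eq_square algebra_simps)
  finally show ?thesis .
qed

lemma sigma_bounds:
  assumes q: "q \<in> Aff_plus" and w: "\<bar>snd q - 1\<bar> \<le> w_coord A q" "w_coord A q \<le> snd q + 1"
  shows "0 \<le> sigma q" and "sigma q \<le> pi"
  using cos_ratio_bounds[OF _ w] q by (auto simp: sigma_def Aff_plus_iff intro: arccos_lbound arccos_ubound)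

lemma sigma_boundary:
  assumes q: "q \<in> Aff_plus" and w: "\<bar>snd q - 1\<bar> \<le> w_coord A q" "w_coord A q \<le> snd q + 1"
  shows "sigma q = 0 \<longleftrightarrow> w_coord A q = \<bar>snd q - 1\<bar>"
    and "sigma q = pi \<longleftrightarrow> w_coord A q = snd q + 1"
proof -
  have y: "snd q > 0" using q by (simp add: Aff_plus_iff)
  have "sigma q = 0 \<longleftrightarrow> (w_coord A q)\<^sup>2 = \<bar>snd q - 1\<bar>\<^sup>2"
    using sigma_eq_iff[OF q _ _ w, of 0] by simp
  also have "\<dots> \<longleftrightarrow> w_coord A q = \<bar>snd q - 1\<bar>"
    using w by (intro power2_eq_iff_nonneg) auto
  finally show "sigma q = 0 \<longleftrightarrow> w_coord A q = \<bar>snd q - 1\<bar>" .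
  have "sigma q = pi \<longleftrightarrow> (w_coord A q)\<^sup>2 = (snd q + 1)\<^sup>2"
    using sigma_eq_iff[OF q _ _ w, of pi] by simp
  also have "\<dots> \<longleftrightarrow> w_coord A q = snd q + 1"
    using w y by (intro power2_eq_iff_nonneg) auto
  finally show "sigma q = pi \<longleftrightarrow> w_coord A q = snd q + 1" .
qed

theorem lorentz_dist_Id:
  assumes q: "q \<in> Aff_plus"
  shows "lorentz_dist A aff_Id q =
    (if w_coord A q < \<bar>snd q - 1\<bar> then 0
     else if w_coord A q \<le> snd q + 1 then ennreal (sigma q / Delta A)
     else \<infinity>)"
proof -
  consider "w_coord A q < \<bar>snd q - 1\<bar>" | "w_coord A q = \<bar>snd q - 1\<bar>" "w_coord A q \<le> snd q + 1"
    | "\<bar>snd q - 1\<bar> < w_coord A q" "w_coord A q < snd q + 1" | "w_coord A q = snd q + 1"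
    | "w_coord A q > snd q + 1"
    using q by (fastforce simp: Aff_plus_iff)
  then show ?thesis
  proof cases
    case 1
    then show ?thesis by (simp add: dist_outside_cone)
  next
    case 2
    then have "sigma q = 0" using sigma_boundary(1)[OF q] by simp
    then show ?thesis using 2 dist_le_sigma[OF q] by simp
  next
    case 3
    then show ?thesis using dist_le_sigma[OF q] dist_ge_sigma[OF q] by (simp add: antisym)
  next
    case 4
    have w: "\<bar>snd q - 1\<bar> \<le> w_coord A q" using 4 q by (auto simp: Aff_plus_iff)
    then have "sigma q = pi" using 4 sigma_boundary(2)[OF q] by simp
    then show ?thesis
      using 4 w dist_le_sigma[OF q] dist_on_F_ge[OF q] by (simp add: antisym)
  next
    case 5
    moreover have "\<not> w_coord A q < \<bar>snd q - 1\<bar>" using 5 q by (auto simp: Aff_plus_iff)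
    ultimately show ?thesis using dist_beyond_F[OF q] by simp
  qed
qed

lemma lorentz_dist_Id_eq_iff:
  assumes q: "q \<in> Aff_plus" and R: "0 < R"
  shows "lorentz_dist A aff_Id q = ennreal R \<longleftrightarrow>
    \<bar>snd q - 1\<bar> \<le> w_coord A q \<and> w_coord A q \<le> snd q + 1 \<and> sigma q = Delta A * R"
  using R Delta_pos sigma_bounds[OF q]
  by (auto simp: lorentz_dist_Id[OF q] field_simps not_less) 

section \<open>The spheres\<close>

lemma sphere_0: "lorentz_sphere A 0 = {q \<in> Aff_plus. lam1 A q \<ge> 0 \<or> lam2 A q \<le> 0}"
proof -
  have "lorentz_dist A aff_Id q = 0 \<longleftrightarrow> lam1 A q \<ge> 0 \<or> lam2 A q \<le> 0" if q: "q \<in> Aff_plus" for q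
  proof -
    have y: "snd q > 0" using q by (simp add: Aff_plus_iff)
    have "lorentz_dist A aff_Id q = 0 \<longleftrightarrow> w_coord A q \<le> \<bar>snd q - 1\<bar>"
    proof (cases "\<bar>snd q - 1\<bar> \<le> w_coord A q \<and> w_coord A q \<le> snd q + 1")
      case True
      then show ?thesis
        using sigma_boundary(1)[OF q] sigma_bounds[OF q] Delta_pos
        by (auto simp: lorentz_dist_Id[OF q] ennreal_eq_0_iff divide_le_0_iff)
    next
      case False
      then show ?thesis using y by (auto simp: lorentz_dist_Id[OF q])
    qed
    then show ?thesis
      by (auto simp: lam1_nonneg_iff lam2_nonpos_iff)
  qed
  then show ?thesis by (auto simp: lorentz_sphere_def)
qed

text \<open>
  Strictness of \<open>- 1 < cos (\<Delta> R) < 1\<close> separates the arc from both boundary lines: its equation reads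
  \<open>w\<^sup>2 = y\<^sup>2 + 1 - 2 y cos (\<Delta> R)\<close>, which lies strictly between \<open>(y - 1)\<^sup>2\<close> and \<open>(y + 1)\<^sup>2\<close>.
\<close>

lemma sphere_arc:
  assumes R: "0 < R" "R < pi / Delta A"
  shows "lorentz_sphere A (ennreal R) = {(x, y) \<in> Aff_plus.
     w_coord A (x, y) > 0 \<and> (w_coord A (x, y))\<^sup>2 - (y - cos (Delta A * R))\<^sup>2 = (sin (Delta A * R))\<^sup>2}"
proof -
  define s where "s = Delta A * R"
  have s: "0 < s" "s < pi"
    using R Delta_pos by (auto simp: s_def field_simps)
  then have cos: "- 1 < cos s" "cos s < 1"
    using cos_monotone_0_pi[of 0 s] cos_monotone_0_pi[of s pi] by auto
  have "lorentz_dist A aff_Id q = ennreal R \<longleftrightarrow>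
    w_coord A q > 0 \<and> (w_coord A q)\<^sup>2 - (snd q - cos s)\<^sup>2 = (sin s)\<^sup>2" if q: "q \<in> Aff_plus" for q
  proof -
    have y: "snd q > 0" using q by (simp add: Aff_plus_iff)
    have range: "\<bar>snd q - 1\<bar> \<le> w_coord A q \<and> w_coord A q \<le> snd q + 1"
      if w: "w_coord A q > 0" "(w_coord A q)\<^sup>2 - (snd q - cos s)\<^sup>2 = (sin s)\<^sup>2"
    proof -
      have *: "(w_coord A q)\<^sup>2 = (snd q)\<^sup>2 + 1 - 2 * snd q * cos s"
        using w(2) sin_cos_squared_add[of s] by (simp add: power2_eq_square algebra_simps)
      have "2 * snd q * cos s \<le> 2 * snd q * 1" "2 * snd q * (- 1) \<le> 2 * snd q * cos s"
        using cos y by (intro mult_left_mono; simp)+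
      then have "\<bar>snd q - 1\<bar>\<^sup>2 \<le> (w_coord A q)\<^sup>2" "(w_coord A q)\<^sup>2 \<le> (snd q + 1)\<^sup>2"
        unfolding * by (simp_all add: power2_eq_square algebra_simps)
      then show ?thesis
        using w(1) y abs_le_square_iff[of "snd q - 1" "w_coord A q"]
          abs_le_square_iff[of "w_coord A q" "snd q + 1"] by auto
    qed
    have pos: "w_coord A q > 0" if "\<bar>snd q - 1\<bar> \<le> w_coord A q" "w_coord A q \<le> snd q + 1" "sigma q = s"
      using sigma_boundary(1)[OF q that(1,2)] that s by auto
    have eq: "sigma q = s \<longleftrightarrow> (w_coord A q)\<^sup>2 - (snd q - cos s)\<^sup>2 = (sin s)\<^sup>2"
      if "\<bar>snd q - 1\<bar> \<le> w_coord A q" "w_coord A q \<le> snd q + 1"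
      using s that by (intro sigma_eq_iff[OF q]) auto
    show ?thesis
      unfolding lorentz_dist_Id_eq_iff[OF q R(1)] s_def[symmetric]
      using range pos eq by blast
  qed
  then show ?thesis
    unfolding s_def[symmetric] by (auto simp: lorentz_sphere_def)
qed

lemma sphere_pi: "lorentz_sphere A (ennreal (pi / Delta A)) = set_F A"
proof -
  have R: "0 < pi / Delta A" using Delta_pos by simp
  have "lorentz_dist A aff_Id q = ennreal (pi / Delta A) \<longleftrightarrow> lam3 A q = 0" if q: "q \<in> Aff_plus" for q
  proof -
    have y: "snd q > 0" using q by (simp add: Aff_plus_iff)
    then have "w_coord A q = snd q + 1 \<Longrightarrow> \<bar>snd q - 1\<bar> \<le> w_coord A q" by auto
    then show ?thesis
      using lorentz_dist_Id_eq_iff[OF q R] sigma_boundary(2)[OF q] Delta_pos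
      by (auto simp: lam3_zero_iff)
  qed
  then show ?thesis by (auto simp: lorentz_sphere_def set_F_def)
qed

lemma sphere_empty:
  assumes "ennreal (pi / Delta A) < R" "R < \<infinity>"
  shows "lorentz_sphere A R = {}"
proof -
  have "lorentz_dist A aff_Id q \<noteq> R" if q: "q \<in> Aff_plus" for q
  proof -
    have "ennreal (sigma q / Delta A) \<le> ennreal (pi / Delta A)"
      if "\<not> w_coord A q < \<bar>snd q - 1\<bar>" "w_coord A q \<le> snd q + 1"
      using sigma_bounds(2)[OF q] that Delta_pos by (intro ennreal_leI divide_right_mono) auto
    then show ?thesis
      using assms by (auto simp: lorentz_dist_Id[OF q])
  qed
  then show ?thesis by (auto simp: lorentz_sphere_def)
qed

lemma sphere_infinity: "lorentz_sphere A \<infinity> = set_E A"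
proof -
  have "lorentz_dist A aff_Id q = \<infinity> \<longleftrightarrow> lam3 A q < 0" if q: "q \<in> Aff_plus" for q
    using q by (auto simp: lorentz_dist_Id[OF q] lam3_neg_iff Aff_plus_iff)
  then show ?thesis by (auto simp: lorentz_sphere_def set_E_def)
qed

text \<open>
  The arc is a graph \<open>w = W y\<close> over \<open>y > 0\<close>, so \<open>t \<mapsto> (W (exp t), exp t)\<close> parametrizes it, and
  \<open>y\<close> leaves every compact subset of the half-line at both ends.  The coefficients of \<open>H\<close> arise from
  the equation of the arc by substituting \<open>w = (x - n (y - 1)) / l\<close> and multiplying by \<open>l\<^sup>2\<close>;
  the determinant of the conic is \<open>l\<^sup>4 (1 - C\<^sup>2)\<close>.
\<close>

lemma arc_noncompact:
  assumes c: "- 1 < C" "C < 1" and S: "S = {(x, y) \<in> Aff_plus.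
     w_coord A (x, y) > 0 \<and> (w_coord A (x, y))\<^sup>2 - (y - C)\<^sup>2 = 1 - C\<^sup>2}"
  shows "hyperbola_arc_noncompact_both S"
proof -
  define n where "n = nu A"
  define l where "l = lam A"
  have l: "l > 0" using lam_pos by (simp add: l_def)
  define H where "H = {(x, y). 1 * x\<^sup>2 + 2 * (- n) * x * y + (n\<^sup>2 - l\<^sup>2) * y\<^sup>2 + 2 * n * x
     + 2 * (l\<^sup>2 * C - n\<^sup>2) * y + (n\<^sup>2 - l\<^sup>2) = 0}"
  have C2: "1 - C\<^sup>2 > 0"
    using c by (simp add: abs_square_less_1 abs_less_iff)
  have "hyperbola H"
    unfolding hyperbola_def
  proof (intro exI conjI)
    show "(- n)\<^sup>2 - 1 * (n\<^sup>2 - l\<^sup>2) > 0" using l by simp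
    have "1 * ((n\<^sup>2 - l\<^sup>2) * (n\<^sup>2 - l\<^sup>2) - (l\<^sup>2 * C - n\<^sup>2)\<^sup>2) - (- n) * ((- n) * (n\<^sup>2 - l\<^sup>2) - n * (l\<^sup>2 * C - n\<^sup>2))
      + n * ((- n) * (l\<^sup>2 * C - n\<^sup>2) - n * (n\<^sup>2 - l\<^sup>2)) = (l\<^sup>2)\<^sup>2 * (1 - C\<^sup>2)"
      by algebra
    then show "1 * ((n\<^sup>2 - l\<^sup>2) * (n\<^sup>2 - l\<^sup>2) - (l\<^sup>2 * C - n\<^sup>2)\<^sup>2) - (- n) * ((- n) * (n\<^sup>2 - l\<^sup>2) - n * (l\<^sup>2 * C - n\<^sup>2))
      + n * ((- n) * (l\<^sup>2 * C - n\<^sup>2) - n * (n\<^sup>2 - l\<^sup>2)) \<noteq> 0"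
      using l C2 by simp
    show "H = {(x, y). 1 * x\<^sup>2 + 2 * (- n) * x * y + (n\<^sup>2 - l\<^sup>2) * y\<^sup>2 + 2 * n * x
     + 2 * (l\<^sup>2 * C - n\<^sup>2) * y + (n\<^sup>2 - l\<^sup>2) = 0}"
      by (rule H_def)
  qed
  moreover have "S \<subseteq> H"
  proof
    fix p assume p: "p \<in> S"
    obtain x y where xy: "p = (x, y)" by force
    define w where "w = w_coord A (x, y)"
    have "x = l * w + n * (y - 1)" using l by (simp add: w_def w_coord_def l_def n_def)
    moreover have "w\<^sup>2 - (y - C)\<^sup>2 = 1 - C\<^sup>2" using p by (simp add: S xy w_def)
    ultimately have "1 * x\<^sup>2 + 2 * (- n) * x * y + (n\<^sup>2 - l\<^sup>2) * y\<^sup>2 + 2 * n * x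
     + 2 * (l\<^sup>2 * C - n\<^sup>2) * y + (n\<^sup>2 - l\<^sup>2) = 0"
      by algebra
    then show "p \<in> H" by (simp add: H_def xy)
  qed
  moreover have "S \<subseteq> Aff_plus" by (auto simp: S)
  moreover define W where "W y = sqrt ((y - C)\<^sup>2 + (1 - C\<^sup>2))" for y
  have Wpos: "W y > 0" and W2: "(W y)\<^sup>2 = (y - C)\<^sup>2 + (1 - C\<^sup>2)" for y
    using C2 zero_le_power2[of "y - C"] unfolding W_def by (simp_all add: add_nonneg_pos add_nonneg_nonneg del: zero_le_power2)
  moreover define g where "g t = (l * W (exp t) + n * (exp t - 1), exp t)" for t
  have g_cont: "continuous_on UNIV g"
    unfolding g_def W_def by (intro continuous_intros)
  have g_inj: "inj g"
    by (auto simp: inj_def g_def)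
  have g_w: "w_coord A (g t) = W (exp t)" for t
    using l by (simp add: w_coord_def g_def l_def n_def)
  have g_range: "range g = S"
  proof (intro equalityI subsetI)
    fix p assume "p \<in> range g"
    then obtain t where p: "p = g t" by auto
    obtain x y where xy: "g t = (x, y)" by force
    then have y: "y = exp t" by (simp add: g_def)
    have "w_coord A (x, y) = W y" using g_w[of t] xy y by simp
    then show "p \<in> S" unfolding p xy S using Wpos[of y] W2[of y] y by (simp add: Aff_plus_def)
  next
    fix p assume p: "p \<in> S"
    obtain x y where xy: "p = (x, y)" by force
    define w where "w = w_coord A (x, y)"
    have y: "y > 0" and w: "w > 0" "w\<^sup>2 - (y - C)\<^sup>2 = 1 - C\<^sup>2"
      using p by (auto simp: S xy w_def Aff_plus_def)
    have x: "x = l * w + n * (y - 1)" using l by (simp add: w_def w_coord_def l_def n_def)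
    have "W y = w"
      unfolding W_def using w by (intro real_sqrt_unique) auto
    then have "p = g (ln y)" using x y by (simp add: g_def xy)
    then show "p \<in> range g" by simp
  qed
  have ends: "(\<forall>\<^sub>F t :: real in at_top. g t \<notin> K) \<and> (\<forall>\<^sub>F t in at_bot. g t \<notin> K)"
    if K: "compact K" "K \<subseteq> Aff_plus" for K
  proof (cases "K = {}")
    case False
    have snd_K: "compact (snd ` K)" "snd ` K \<noteq> {}"
      using K(1) False by (auto intro!: compact_continuous_image continuous_intros)
    obtain m where m: "m \<in> snd ` K" "\<And>y. y \<in> snd ` K \<Longrightarrow> m \<le> y"
      using compact_attains_inf[OF snd_K] by auto
    obtain M where M: "\<And>y. y \<in> snd ` K \<Longrightarrow> y \<le> M"
      using compact_attains_sup[OF snd_K] by auto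
    have "m > 0" using m(1) K(2) by (auto simp: Aff_plus_iff)
    have "\<forall>\<^sub>F t :: real in at_top. exp t > M"
      using exp_at_top by (auto simp: filterlim_at_top_dense)
    moreover have "\<forall>\<^sub>F t :: real in at_bot. exp t < m"
      using exp_at_bot \<open>m > 0\<close> by (auto dest: order_tendstoD(2))
    moreover have "g t \<notin> K" if "exp t > M \<or> exp t < m" for t
      using M[of "exp t"] m(2)[of "exp t"] that by (force simp: g_def)
    ultimately show ?thesis
      by (auto elim: eventually_mono)
  qed simp
  show ?thesis
    unfolding hyperbola_arc_noncompact_both_def
    using \<open>hyperbola H\<close> \<open>S \<subseteq> H\<close> \<open>S \<subseteq> Aff_plus\<close> g_cont g_inj g_range ends by blast
qed

end

theorem corollary4:
  fixes A :: "real^2^2"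
  assumes "det A > 0" and "A $ 1 $ 1 \<ge> 0" and "sectional_curvature A < 0"
  shows
    "lorentz_sphere A 0 = {q \<in> Aff_plus. lam1 A q \<ge> 0 \<or> lam2 A q \<le> 0} \<and>
     (\<forall>R::real. 0 < R \<and> R < pi / Delta A \<longrightarrow>
        lorentz_sphere A (ennreal R) =
          {(x, y) \<in> Aff_plus.
             let w = w_coord A (x, y); \<sigma> = Delta A * R
             in w > 0 \<and> w\<^sup>2 - (y - cos \<sigma>)\<^sup>2 = (sin \<sigma>)\<^sup>2} \<and>
        hyperbola_arc_noncompact_both (lorentz_sphere A (ennreal R))) \<and>
     lorentz_sphere A (ennreal (pi / Delta A)) = set_F A \<and>
     (\<forall>R::ennreal. ennreal (pi / Delta A) < R \<and> R < \<infinity> \<longrightarrow> lorentz_sphere A R = {}) \<and>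
     lorentz_sphere A \<infinity> = set_E A"
proof -
  interpret negative_curvature A
    using assms by unfold_locales
  have "hyperbola_arc_noncompact_both (lorentz_sphere A (ennreal R))" if R: "0 < R" "R < pi / Delta A" for R
  proof (rule arc_noncompact)
    have "0 < Delta A * R" "Delta A * R < pi"
      using R Delta_pos by (auto simp: field_simps)
    then show "- 1 < cos (Delta A * R)" "cos (Delta A * R) < 1"
      using cos_monotone_0_pi[of 0 "Delta A * R"] cos_monotone_0_pi[of "Delta A * R" pi] by auto
  qed (simp only: sphere_arc[OF R] sin_squared_eq)
  then show ?thesis
    unfolding Let_def
    by (intro conjI allI impI sphere_0 sphere_arc sphere_pi sphere_empty sphere_infinity) simp_all
qed

end
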